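(* Let the data be as in the context. Functions $\varepsilon,\varepsilon_{\rm el},\varepsilon_{\rm p},\sigma\in W^{1,\infty}(I,\mathcal{H})$ solve the abstract problem of quasi-static evolution in elasticity-perfect plasticity if and only if the unknown $$y=\sigma-\widetilde\sigma\in W^{1,\infty}(I,\mathcal{H}_{\mathbf{C}^{-1}})$$ and the unknown $\varepsilon\in W^{1,\infty}(I,\mathcal{H})$ solve the differential inclusions $$-\frac{d}{dt}\bm y\in N^{\mathbf{C}^{-1}}_{\mathcal{C}(t)}(\bm y),$$ $$\frac{d}{dt}\bm\varepsilon\in\mathbf{C}^{-1}\left(\left(N^{\mathbf{C}^{-1}}_{\Sigma-\bm{\widetilde\sigma}(t)}(\bm y)+\frac{d}{dt}\bm y\right)\cap\mathcal{U}+\frac{d}{dt}\bm{\widetilde\sigma}(t)\right)$$ with the initial conditions $$\bm y(0)=\bm\sigma_{\bf 0}-\bm{\widetilde\sigma}(0)\in\mathcal{C}(0),\qquad \bm\varepsilon(0)=\bm\varepsilon_{\bf 0}\in\mathbf{C}^{-1}(\mathcal{U}+\bm{\widetilde\sigma}(0)),$$ where the moving set is $$\mathcal{C}(t)=(\Sigma-\bm{\widetilde\sigma}(t))\cap\mathcal{V}.$$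
   Context: All spaces are real and $I=[0,T]$ with $T>0$. For a function $h$ on $I$, $\bm h(t)$ denotes its value at $t$. Spaces and operators. $\mathcal{H}$ is a separable Hilbert space, $\mathcal{X}$ is a reflexive Banach space, $\mathcal{W}_0\subset\mathcal{X}$ is a linear (not necessarily closed) subspace, $\mathbf{E}:\mathcal{W}_0\subset\mathcal{X}\to\mathcal{H}$ is a linear operator which is closed (closed graph in $\mathcal X\times\mathcal H$) and has closed image. $\mathcal{X}_0=\overline{\mathcal{W}_0}$ (closure in $\mathcal{X}$). $\mathbf{D}:D(\mathbf{D})\subset\mathcal{H}\to\mathcal{X}_0^*$ is the adjoint, in the sense of unbounded operators, of $\mathbf{E}$ regarded as a densely defined operator from $\mathcal{X}_0$ to $\mathcal{H}$. $\mathbf{C}:\mathcal{H}\to\mathcal{H}$ is linear, bounded, symmetric, and coercive ($\langle\mathbf C\bm\tau,\bm\tau\rangle\ge c_0\|\bm\tau\|^2$ for all $\bm\tau\in\mathcal H$, for some $c_0>0$). The loads are $g\in W^{1,\infty}(I,\mathcal{H})$ and $f\in W^{1,\infty}(I,\mathrm{Im}\,\mathbf{D})$. Weighted space. $\mathcal{H}_{\mathbf{C}^{-1}}$ is $\mathcal{H}$ with the inner product $\langle\bm\sigma,\bm\tau\rangle_{\mathbf{C}^{-1}}=\langle\bm\sigma,\mathbf{C}^{-1}\bm\tau\rangle_{\mathcal{H}}$. $\mathcal{U}=\mathrm{Im}(\mathbf{C}\mathbf{E})$ and $\mathcal{V}=\mathrm{Ker}\,\mathbf{D}$ are closed orthogonal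 complements of each other in $\mathcal{H}_{\mathbf{C}^{-1}}$; $P_{\mathcal V}$ is the orthogonal projection of $\mathcal{H}_{\mathbf{C}^{-1}}$ onto $\mathcal{V}$; $G=P_{\mathcal V}\mathbf{C}$; $Q:\mathrm{Im}\,\mathbf{D}\to\mathcal{U}$ is the (bounded) inverse of the bijection $\mathcal{U}\cap D(\mathbf{D})\to\mathrm{Im}\,\mathbf{D}$, $\bm\sigma\mapsto\mathbf{D}\bm\sigma$. The stress solution for elasticity is the known function $\bm{\widetilde\sigma}(t)=G\bm g(t)+Q\bm f(t)$, which belongs to $W^{1,\infty}(I,\mathcal{H}_{\mathbf{C}^{-1}})$. Normal cones. For a closed convex nonempty set $\mathcal{C}$ in a Hilbert space and $\bm x\in\mathcal{C}$, $N_{\mathcal C}(\bm x)=\{\bm z:\langle\bm z,\bm c-\bm x\rangle\le0\ \forall\bm c\in\mathcal{C}\}$. $N$ denotes the normal cone in $\mathcal{H}$, $N^{\mathbf{C}^{-1}}$ the normal cone in $\mathcal{H}_{\mathbf{C}^{-1}}$ (with its inner product). The first differential inclusion is a sweeping process; by definition, $y$ is a solution of it if $\bm y(t)\in\mathcal{C}(t)$ for all $t\in I$, and $\frac{d}{dt}\bm y(t)$ exists and the inclusion holds for a.a. $t\in I$, together with the initial condition. The second inclusion is understood for a.a. $t\in I$. Problem of elasticity-perfect plasticity. $\Sigma\subset\mathcal{H}$ is a given bounded closed convex nonempty set. Functions $\varepsilon,\varepsilon_{\rm el},\varepsilon_{\rm p},\sigma\in W^{1,\infty}(I,\mathcal{H})$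 solve the abstract problem of quasi-static evolution in elasticity-perfect plasticity if (EPP1) $\bm\varepsilon\in\mathrm{Im}\,\mathbf{E}+\bm g$; (EPP2) $\bm\varepsilon=\bm{\varepsilon_{\bf el}}+\bm{\varepsilon_{\bf p}}$; (EPP3) $\bm\sigma=\mathbf{C}\,\bm{\varepsilon_{\bf el}}$; (EPP4) $\frac{d}{dt}\bm{\varepsilon_{\bf p}}\in N_\Sigma(\bm\sigma)$; (EPP5) $\bm\sigma\in D(\mathbf{D})$ and $\mathbf{D}\bm\sigma=\bm f$; where (EPP1)–(EPP3), (EPP5) hold for all $t\in I$ and (EPP4) for a.a. $t\in I$, together with the initial condition $(\bm\varepsilon(0),\bm{\varepsilon_{\bf el}}(0),\bm{\varepsilon_{\bf p}}(0),\bm\sigma(0))=(\bm\varepsilon_{\bf 0},\bm\varepsilon_{\bf el0},\bm\varepsilon_{\bf p0},\bm\sigma_{\bf 0})$, whose given right-hand side in $\mathcal{H}^4$ satisfies (EPP1)–(EPP3), (EPP5) at $t=0$ and $\bm\sigma_{\bf 0}\in\Sigma$.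
   Formalization: The right-hand side of the equivalence also states that ε_el = C^{-1}σ and ε_p = ε − C^{-1}σ on I; without this the inclusions for y and ε leave ε_el and ε_p unconstrained and the "if" direction fails as literally written. *)

theory Defs
  imports "HOL-Analysis.Analysis"
begin

section \<open>Reflexivity and duals of subspaces\<close>

definition reflexive_space :: "'x::real_normed_vector itself \<Rightarrow> bool" where
  "reflexive_space _ \<longleftrightarrow>
     (\<forall>\<Phi> :: ('x \<Rightarrow>\<^sub>L real) \<Rightarrow>\<^sub>L real. \<exists>x :: 'x. \<forall>\<phi>. blinfun_apply \<Phi> \<phi> = blinfun_apply \<phi> x)"

definition linear_on_subspace :: "'x::real_vector set \<Rightarrow> ('x \<Rightarrow> 'b::real_vector) \<Rightarrow> bool" where
  "linear_on_subspace W A \<longleftrightarrow> subspace W \<and>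
     (\<forall>x\<in>W. \<forall>y\<in>W. A (x + y) = A x + A y) \<and> (\<forall>c. \<forall>x\<in>W. A (c *\<^sub>R x) = c *\<^sub>R A x)"

text \<open>The dual of a subspace \<open>S\<close> consists of functionals defined on \<open>S\<close> only; they are made
  extensional, so that equality of functionals is equality on \<open>S\<close>.\<close>

definition dual_of :: "'x::real_normed_vector set \<Rightarrow> ('x \<Rightarrow> real) set" where
  "dual_of S = {\<phi> \<in> extensional S. linear_on_subspace S \<phi> \<and>
                  (\<exists>K. \<forall>x\<in>S. \<bar>\<phi> x\<bar> \<le> K * norm x)}"

definition dual_norm :: "'x::real_normed_vector set \<Rightarrow> ('x \<Rightarrow> real) \<Rightarrow> real" where
  "dual_norm S \<phi> = (SUP x\<in>{x \<in> S. norm x \<le> 1}. \<bar>\<phi> x\<bar>)"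


section \<open>The adjoint of a densely defined operator\<close>

text \<open>For \<open>E\<close> with domain \<open>W0\<close>, regarded as densely defined in \<open>closure W0\<close>; the Hilbert space
  is identified with its dual.\<close>

definition adj_dom :: "'x::real_normed_vector set \<Rightarrow> ('x \<Rightarrow> 'h::real_inner) \<Rightarrow> 'h set" where
  "adj_dom W0 E = {\<sigma>. \<exists>K. \<forall>e\<in>W0. \<bar>inner \<sigma> (E e)\<bar> \<le> K * norm e}"

definition adj :: "'x::real_normed_vector set \<Rightarrow> ('x \<Rightarrow> 'h::real_inner) \<Rightarrow> 'h \<Rightarrow> ('x \<Rightarrow> real)" where
  "adj W0 E \<sigma> = (THE \<phi>. \<phi> \<in> dual_of (closure W0) \<and> (\<forall>e\<in>W0. \<phi> e = inner \<sigma> (E e)))"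

definition adj_image :: "'x::real_normed_vector set \<Rightarrow> ('x \<Rightarrow> 'h::real_inner) \<Rightarrow> ('x \<Rightarrow> real) set" where
  "adj_image W0 E = adj W0 E ` adj_dom W0 E"

definition adj_ker :: "'x::real_normed_vector set \<Rightarrow> ('x \<Rightarrow> 'h::real_inner) \<Rightarrow> 'h set" where
  "adj_ker W0 E = {\<sigma> \<in> adj_dom W0 E. adj W0 E \<sigma> = (\<lambda>x\<in>closure W0. 0)}"


section \<open>The weighted inner product\<close>

definition inner_inv :: "('h \<Rightarrow> 'h) \<Rightarrow> 'h::real_inner \<Rightarrow> 'h \<Rightarrow> real" where
  "inner_inv C \<sigma> \<tau> = inner \<sigma> (inv C \<tau>)"

definition norm_inv :: "('h \<Rightarrow> 'h) \<Rightarrow> 'h::real_inner \<Rightarrow> real" where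
  "norm_inv C \<sigma> = sqrt (inner_inv C \<sigma> \<sigma>)"

definition space_U :: "'x::real_normed_vector set \<Rightarrow> ('x \<Rightarrow> 'h::real_inner) \<Rightarrow> ('h \<Rightarrow> 'h) \<Rightarrow> 'h set" where
  "space_U W0 E C = (\<lambda>e. C (E e)) ` W0"

definition proj_inv :: "('h \<Rightarrow> 'h) \<Rightarrow> 'h::real_inner set \<Rightarrow> 'h \<Rightarrow> 'h" where
  "proj_inv C V x = (THE p. p \<in> V \<and> (\<forall>v\<in>V. inner_inv C (x - p) v = 0))"

definition op_G :: "'x::real_normed_vector set \<Rightarrow> ('x \<Rightarrow> 'h::real_inner) \<Rightarrow> ('h \<Rightarrow> 'h) \<Rightarrow> 'h \<Rightarrow> 'h" where
  "op_G W0 E C \<tau> = proj_inv C (adj_ker W0 E) (C \<tau>)"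

definition op_Q :: "'x::real_normed_vector set \<Rightarrow> ('x \<Rightarrow> 'h::real_inner) \<Rightarrow> ('h \<Rightarrow> 'h) \<Rightarrow> ('x \<Rightarrow> real) \<Rightarrow> 'h" where
  "op_Q W0 E C \<phi> = (THE \<sigma>. \<sigma> \<in> space_U W0 E C \<inter> adj_dom W0 E \<and> adj W0 E \<sigma> = \<phi>)"

definition elastic_stress ::
  "'x::real_normed_vector set \<Rightarrow> ('x \<Rightarrow> 'h::real_inner) \<Rightarrow> ('h \<Rightarrow> 'h) \<Rightarrow> (real \<Rightarrow> 'h) \<Rightarrow>
   (real \<Rightarrow> 'x \<Rightarrow> real) \<Rightarrow> real \<Rightarrow> 'h" where
  "elastic_stress W0 E C g f t = op_G W0 E C (g t) + op_Q W0 E C (f t)"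


section \<open>Sobolev spaces of functions of time\<close>

text \<open>A function in \<open>W\<^sup>1\<^sup>,\<^sup>\<infinity>(I, H)\<close>, \<open>I = [0,T]\<close>, is identified with its continuous representative,
  the primitive of an essentially bounded Bochner measurable function. The norm \<open>nrm\<close> enters the
  essential bound. It may be any norm equivalent to the one of the type: measurability (which is
  strong measurability, as the type is separable) and the Bochner integral depend on the topology
  only.\<close>

definition W1_inf ::
  "real \<Rightarrow> ('h \<Rightarrow> real) \<Rightarrow> (real \<Rightarrow> 'h::{banach,second_countable_topology}) \<Rightarrow> bool" where
  "W1_inf T nrm u \<longleftrightarrow>
     (\<exists>v. v \<in> borel_measurable (lebesgue_on {0..T}) \<and>
          (\<exists>K. AE t in lebesgue_on {0..T}. nrm (v t) \<le> K) \<and>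
          (\<forall>t\<in>{0..T}. u t = u 0 + (LINT s:{0..t}|lebesgue. v s)))"

text \<open>The same for values in a normed subspace \<open>R\<close> of the dual of \<open>S\<close>. This dual need not be
  separable, so \<open>v\<close> is required to be strongly measurable, i.e. an a.e. limit of simple functions
  in the dual norm. Equality of functionals is tested pointwise, and the Bochner integral commutes
  with the evaluation at \<open>x\<close>.\<close>

definition W1_inf_dual ::
  "real \<Rightarrow> 'x::real_normed_vector set \<Rightarrow> ('x \<Rightarrow> real) set \<Rightarrow> (real \<Rightarrow> 'x \<Rightarrow> real) \<Rightarrow> bool" where
  "W1_inf_dual T S R u \<longleftrightarrow>
     (\<forall>t\<in>{0..T}. u t \<in> R) \<and>
     (\<exists>v. (\<forall>t\<in>{0..T}. v t \<in> R) \<and>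
          (\<exists>s. (\<forall>n. simple_function (lebesgue_on {0..T}) (s n)) \<and>
               (\<forall>n. \<forall>t\<in>{0..T}. s n t \<in> R) \<and>
               (AE t in lebesgue_on {0..T}.
                  (\<lambda>n::nat. dual_norm S (\<lambda>x. s n t x - v t x)) \<longlonglongrightarrow> 0)) \<and>
          (\<exists>K. AE t in lebesgue_on {0..T}. dual_norm S (v t) \<le> K) \<and>
          (\<forall>t\<in>{0..T}. \<forall>x\<in>S. u t x = u 0 x + (LINT s:{0..t}|lebesgue. v s x)))"

definition ddt :: "real \<Rightarrow> (real \<Rightarrow> 'h::real_normed_vector) \<Rightarrow> real \<Rightarrow> 'h" where
  "ddt T u t = vector_derivative u (at t within {0..T})"

definition has_ddt :: "real \<Rightarrow> (real \<Rightarrow> 'h::real_normed_vector) \<Rightarrow> real \<Rightarrow> bool" where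
  "has_ddt T u t \<longleftrightarrow> u differentiable (at t within {0..T})"


section \<open>Normal cones and the two problems\<close>

text \<open>The normal cone is relative to an inner product \<open>ip\<close> and is empty at points outside the set.\<close>

definition normal_cone :: "('h \<Rightarrow> 'h \<Rightarrow> real) \<Rightarrow> 'h::real_vector set \<Rightarrow> 'h \<Rightarrow> 'h set" where
  "normal_cone ip A x = {z. x \<in> A \<and> (\<forall>c\<in>A. ip z (c - x) \<le> 0)}"

definition translate :: "'h::real_vector set \<Rightarrow> 'h \<Rightarrow> 'h set" where
  "translate A a = (\<lambda>x. x + a) ` A"

text \<open>The relations that hold for all times (all but the flow rule), at one instant: \<open>gt\<close>, \<open>ft\<close> are
  the values of the loads and \<open>e\<close>, \<open>eel\<close>, \<open>ep\<close>, \<open>s\<close> those of total strain, elastic strain, plastic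
  strain and stress.\<close>

definition EPP_static ::
  "'x::real_normed_vector set \<Rightarrow> ('x \<Rightarrow> 'h::real_inner) \<Rightarrow> ('h \<Rightarrow> 'h) \<Rightarrow> 'h \<Rightarrow> ('x \<Rightarrow> real) \<Rightarrow>
   'h \<Rightarrow> 'h \<Rightarrow> 'h \<Rightarrow> 'h \<Rightarrow> bool" where
  "EPP_static W0 E C gt ft e eel ep s \<longleftrightarrow>
     e \<in> translate (E ` W0) gt \<and>
     e = eel + ep \<and>
     s = C eel \<and>
     s \<in> adj_dom W0 E \<and> adj W0 E s = ft"

definition EPP_solution ::
  "real \<Rightarrow> 'x::real_normed_vector set \<Rightarrow> ('x \<Rightarrow> 'h) \<Rightarrow> ('h \<Rightarrow> 'h) \<Rightarrow> (real \<Rightarrow> 'h) \<Rightarrow>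
   (real \<Rightarrow> 'x \<Rightarrow> real) \<Rightarrow> 'h set \<Rightarrow> 'h \<times> 'h \<times> 'h \<times> 'h \<Rightarrow>
   (real \<Rightarrow> 'h) \<Rightarrow> (real \<Rightarrow> 'h) \<Rightarrow> (real \<Rightarrow> 'h) \<Rightarrow>
   (real \<Rightarrow> 'h::{real_inner,banach,second_countable_topology}) \<Rightarrow> bool" where
  "EPP_solution T W0 E C g f \<Sigma> init \<epsilon> \<epsilon>el \<epsilon>p \<sigma> \<longleftrightarrow>
     W1_inf T norm \<epsilon> \<and> W1_inf T norm \<epsilon>el \<and> W1_inf T norm \<epsilon>p \<and> W1_inf T norm \<sigma> \<and>
     (\<forall>t\<in>{0..T}. EPP_static W0 E C (g t) (f t) (\<epsilon> t) (\<epsilon>el t) (\<epsilon>p t) (\<sigma> t)) \<and>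
     (AE t in lebesgue_on {0..T}.
        has_ddt T \<epsilon>p t \<and> ddt T \<epsilon>p t \<in> normal_cone inner \<Sigma> (\<sigma> t)) \<and>
     (\<epsilon> 0, \<epsilon>el 0, \<epsilon>p 0, \<sigma> 0) = init"

definition moving_set ::
  "'x::real_normed_vector set \<Rightarrow> ('x \<Rightarrow> 'h::real_inner) \<Rightarrow> 'h set \<Rightarrow> (real \<Rightarrow> 'h) \<Rightarrow> real \<Rightarrow> 'h set" where
  "moving_set W0 E \<Sigma> st t = translate \<Sigma> (- st t) \<inter> adj_ker W0 E"

text \<open>The sweeping process for \<open>y\<close>, where \<open>st\<close> is the stress solution for elasticity.
  Differentiability in the weighted norm is differentiability in the norm of the type, the norms
  being equivalent.\<close>

definition sweeping_solution ::
  "real \<Rightarrow> 'x::real_normed_vector set \<Rightarrow> ('x \<Rightarrow> 'h) \<Rightarrow> ('h \<Rightarrow> 'h) \<Rightarrow> 'h set \<Rightarrow> (real \<Rightarrow> 'h) \<Rightarrow>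
   'h \<Rightarrow> (real \<Rightarrow> 'h::{real_inner,banach,second_countable_topology}) \<Rightarrow> bool" where
  "sweeping_solution T W0 E C \<Sigma> st y0 y \<longleftrightarrow>
     W1_inf T (norm_inv C) y \<and>
     (\<forall>t\<in>{0..T}. y t \<in> moving_set W0 E \<Sigma> st t) \<and>
     (AE t in lebesgue_on {0..T}.
        has_ddt T y t \<and>
        - ddt T y t \<in> normal_cone (inner_inv C) (moving_set W0 E \<Sigma> st t) (y t)) \<and>
     y 0 = y0 \<and> y0 \<in> moving_set W0 E \<Sigma> st 0"

definition strain_solution ::
  "real \<Rightarrow> 'x::real_normed_vector set \<Rightarrow> ('x \<Rightarrow> 'h) \<Rightarrow> ('h \<Rightarrow> 'h) \<Rightarrow> 'h set \<Rightarrow> (real \<Rightarrow> 'h) \<Rightarrow>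
   (real \<Rightarrow> 'h) \<Rightarrow> 'h \<Rightarrow> (real \<Rightarrow> 'h::{real_inner,banach,second_countable_topology}) \<Rightarrow> bool" where
  "strain_solution T W0 E C \<Sigma> st y \<epsilon>0 \<epsilon> \<longleftrightarrow>
     W1_inf T norm \<epsilon> \<and>
     (AE t in lebesgue_on {0..T}.
        has_ddt T \<epsilon> t \<and> has_ddt T y t \<and> has_ddt T st t \<and>
        ddt T \<epsilon> t \<in> inv C `
          translate
            (translate (normal_cone (inner_inv C) (translate \<Sigma> (- st t)) (y t)) (ddt T y t)
               \<inter> space_U W0 E C)
            (ddt T st t)) \<and>
     \<epsilon> 0 = \<epsilon>0 \<and> \<epsilon>0 \<in> inv C ` translate (space_U W0 E C) (st 0)"

end

theory Submission
  imports Defs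
begin

text \<open>
  Put \<open>A = C\<inverse>\<close>, \<open>y = \<sigma> - st\<close> and \<open>w = C \<epsilon> - st\<close>. Compatibility of the total strain says that \<open>w\<close>
  stays in \<open>U\<close>, equilibrium says that \<open>y\<close> stays in \<open>V\<close>, and both spaces are closed and orthogonal
  complements for the weighted inner product. Hence \<open>w\<close> stays in \<open>U\<close> iff it starts there and its
  derivative is in \<open>U\<close> almost everywhere. Since \<open>w' = y' + C \<epsilon>p'\<close> and \<open>C\<close> carries the normal cone
  of \<open>\<Sigma>\<close> at \<open>\<sigma>\<close> to the weighted normal cone of \<open>\<Sigma> - st\<close> at \<open>y\<close>, the flow rule is the inclusion
  for \<open>\<epsilon>'\<close>. The sweeping process follows because \<open>- y' = C \<epsilon>p' - w'\<close> and \<open>w'\<close> annihilates the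
  differences of points of the moving set, which lie in \<open>V\<close>. That \<open>\<sigma>\<close> lies in \<open>\<Sigma>\<close> at every time, and
  not only almost always, is due to continuity.

  The analytic input is the almost everywhere differentiability of primitives of bounded
  Hilbert-valued functions and the boundedness of \<open>Q\<close>, which comes from the open mapping theorem
  and puts \<open>st\<close> in \<open>W\<^sup>1\<^sup>,\<^sup>\<infinity>\<close>.
\<close>

section \<open>Lebesgue points\<close>

text \<open>A disjoint Vitali family of balls, in each of which \<open>S\<close> misses a fixed proportion, chosen inside
  an open set exceeding \<open>S\<close> by little, has small total length.\<close>

lemma negligible_nondensity:
  fixes S :: "real set"
  assumes S: "S \<in> lmeasurable" and \<epsilon>: "\<epsilon> > 0"
  shows "negligible {t \<in> S. \<forall>d>0. \<exists>r. 0 < r \<and> r < d \<and> \<epsilon> * r < measure lebesgue (ball t r - S)}"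
    (is "negligible ?N")
  unfolding negligible_outer_le
proof (intro allI impI)
  fix e :: real assume e: "e > 0"
  \<comment> \<open>Chosen so that \<open>(2 / \<epsilon>) * \<delta> = e\<close>, where
    \<open>2 / \<epsilon>\<close> bounds the length of a selected ball by its part outside
    \<open>S\<close>.\<close>
  define \<delta> where "\<delta> = e * \<epsilon> / 2"
  have "\<delta> > 0" using e \<epsilon> by (simp add: \<delta>_def)
  then obtain U where U: "open U" "S \<subseteq> U" "U - S \<in> lmeasurable" "emeasure lebesgue (U - S) < ennreal \<delta>"
    using sets_lebesgue_outer_open[of S \<delta>] S by (metis fmeasurableD)
  have mU: "measure lebesgue (U - S) \<le> \<delta>"
    using U(3,4) \<open>\<delta> > 0\<close> by (simp add: emeasure_eq_measure2 ennreal_less_iff)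
  define K where "K = {(x,r). 0 < r \<and> ball x r \<subseteq> U \<and> \<epsilon> * r < measure lebesgue (ball x r - S)}"
  obtain D where D: "countable D" "D \<subseteq> K"
     "pairwise (\<lambda>i j. disjnt (ball (fst i) (snd i)) (ball (fst j) (snd j))) D"
     "negligible (?N - (\<Union>i \<in> D. ball (fst i) (snd i)))"
  proof (rule Vitali_covering_theorem_balls[of ?N K fst snd])
    fix x d :: real assume x: "x \<in> ?N" and d: "0 < d"
    then have "x \<in> U" using U by auto
    then obtain k where k: "k > 0" "ball x k \<subseteq> U" using \<open>open U\<close> by (meson openE)
    obtain r where r: "0 < r" "r < min d k" "\<epsilon> * r < measure lebesgue (ball x r - S)"
      using x d k by (auto dest!: spec[of _ "min d k"])
    have "ball x r \<subseteq> U" using r k by (meson dual_order.trans less_imp_le min.strict_boundedE subset_ball)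
    then show "\<exists>i. i \<in> K \<and> x \<in> ball (fst i) (snd i) \<and> snd i < d"
      using r by (intro exI[of _ "(x,r)"]) (auto simp: K_def)
  qed blast
  let ?B = "\<lambda>i::real\<times>real. ball (fst i) (snd i)"
  \<comment> \<open>A bound for finite subfamilies carries over to the countable union. A ball of
    radius \<open>r\<close> has length \<open>2 * r\<close> and misses \<open>S\<close> by more than
    \<open>\<epsilon> * r\<close>; by disjointness the missed parts add up inside
    \<open>U - S\<close>.\<close>
  have fin: "measure lebesgue (\<Union>i\<in>F. ?B i) \<le> e" if F: "F \<subseteq> D" "finite F" for F
  proof -
    have le: "measure lebesgue (?B i) \<le> (2 / \<epsilon>) * measure lebesgue (?B i - S)" if "i \<in> F" for i
    proof -
      have i: "0 < snd i" "\<epsilon> * snd i < measure lebesgue (?B i - S)"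
        using that F D(2) by (auto simp: K_def)
      have "measure lebesgue (?B i) = 2 * snd i"
        using i by (simp add: ball_eq_greaterThanLessThan)
      then show ?thesis using i \<epsilon> by (simp add: field_simps)
    qed
    have dis: "disjoint_family_on (\<lambda>i. ?B i - S) F"
      using D(3) F(1) unfolding disjoint_family_on_def pairwise_def disjnt_def by blast
    have mB: "?B i - S \<in> lmeasurable" for i
      using S by (intro fmeasurable_Diff) auto
    have "measure lebesgue (\<Union>i\<in>F. ?B i) \<le> (\<Sum>i\<in>F. measure lebesgue (?B i))"
      using F by (intro measure_UNION_le) auto
    also have "\<dots> \<le> (\<Sum>i\<in>F. (2 / \<epsilon>) * measure lebesgue (?B i - S))"
      by (intro sum_mono le)
    also have "\<dots> = (2 / \<epsilon>) * measure lebesgue (\<Union>i\<in>F. ?B i - S)"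
    proof -
      have "emeasure lebesgue (?B i - S) \<noteq> \<infinity>" for i
        using fmeasurableD2[OF mB] by (metis infinity_ennreal_def)
      then have "measure lebesgue (\<Union>i\<in>F. ?B i - S) = (\<Sum>i\<in>F. measure lebesgue (?B i - S))"
        using mB by (intro measure_finite_Union[OF F(2) _ dis]) (auto dest: fmeasurableD)
      then show ?thesis by (simp only: sum_distrib_left)
    qed
    also have "\<dots> \<le> (2 / \<epsilon>) * measure lebesgue (U - S)"
    proof (intro mult_left_mono measure_mono_fmeasurable)
        have "?B i \<subseteq> U" if "i \<in> F" for i
        proof -
          have "i \<in> K" using that F(1) D(2) by blast
          then show ?thesis by (cases i) (auto simp: K_def)
        qed
        then show "(\<Union>i\<in>F. ?B i - S) \<subseteq> U - S" by blast
        show "(\<Union>i\<in>F. ?B i - S) \<in> sets lebesgue"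
          using mB F(2) by (blast intro: sets.finite_UN fmeasurableD)
      qed (use \<epsilon> U in auto)
    also have "\<dots> \<le> (2 / \<epsilon>) * \<delta>" using mU \<epsilon> by (intro mult_left_mono) auto
    also have "\<dots> = e" using \<epsilon> by (simp add: \<delta>_def)
    finally show ?thesis .
  qed
  have mB: "?B i \<in> lmeasurable" for i by simp
  have UB: "(\<Union>i\<in>D. ?B i) \<in> lmeasurable" "measure lebesgue (\<Union>i\<in>D. ?B i) \<le> e"
    using fmeasurable_UN_bound[OF D(1) mB fin] measure_UN_bound[OF D(1) mB fin] by auto
  show "\<exists>T. ?N \<subseteq> T \<and> T \<in> lmeasurable \<and> measure lebesgue T \<le> e"
  proof (intro exI conjI)
    \<comment> \<open>The balls cover \<open>?N\<close> only up to a null set, which is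
      adjoined.\<close>
    let ?T = "(\<Union>i\<in>D. ?B i) \<union> (?N - (\<Union>i\<in>D. ?B i))"
    show "?N \<subseteq> ?T" by blast
    show "?T \<in> lmeasurable" using UB D(4) by (intro fmeasurable.Un) (auto simp: negligible_imp_measurable)
    have "measure lebesgue ?T \<le> measure lebesgue (\<Union>i\<in>D. ?B i) + measure lebesgue (?N - (\<Union>i\<in>D. ?B i))"
      using UB D(4) by (intro measure_Un_le) (auto simp: negligible_imp_sets)
    then show "measure lebesgue ?T \<le> e" using UB D(4) by (simp add: negligible_imp_measure0)
  qed
qed

text \<open>The condition weakens as \<epsilon> grows, so the values \<open>1 / (n + 1)\<close>
  suffice and countably many negligible sets are discarded.\<close>

lemma AE_density_point:
  fixes S :: "real set"
  assumes "S \<in> lmeasurable"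
  shows "AE t in lebesgue. t \<in> S \<longrightarrow>
     (\<forall>\<epsilon>>0. \<exists>d>0. \<forall>r. 0 < r \<and> r < d \<longrightarrow> measure lebesgue (ball t r - S) \<le> \<epsilon> * r)"
proof -
  let ?N = "\<lambda>\<epsilon>. {t \<in> S. \<forall>d>0. \<exists>r. 0 < r \<and> r < d \<and> \<epsilon> * r < measure lebesgue (ball t r - S)}"
  have "AE t in lebesgue. \<forall>n. t \<notin> ?N (inverse (real (Suc n)))"
    unfolding AE_all_countable
    using negligible_nondensity[OF assms] by (intro allI AE_not_in) (simp add: negligible_iff_null_sets)
  then show ?thesis
  proof eventually_elim
    case (elim t)
    show ?case
    proof (intro impI allI)
      fix \<epsilon> :: real assume "t \<in> S" "\<epsilon> > 0"
      obtain n where n: "inverse (real (Suc n)) < \<epsilon>" using reals_Archimedean[OF \<open>\<epsilon> > 0\<close>] by blast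
      define \<delta> where "\<delta> = inverse (real (Suc n))"
      have "\<not> (\<forall>d>0. \<exists>r. 0 < r \<and> r < d \<and> \<delta> * r < measure lebesgue (ball t r - S))"
        using spec[OF elim, of n] \<open>t \<in> S\<close> unfolding \<delta>_def by blast
      then obtain d where d: "d > 0" "\<And>r. 0 < r \<Longrightarrow> r < d \<Longrightarrow> measure lebesgue (ball t r - S) \<le> \<delta> * r"
        by (meson not_less)
      have "measure lebesgue (ball t r - S) \<le> \<epsilon> * r" if "0 < r" "r < d" for r
        using d(2)[OF that] mult_right_mono[of \<delta> \<epsilon> r] n that unfolding \<delta>_def by linarith
      then show "\<exists>d>0. \<forall>r. 0 < r \<and> r < d \<longrightarrow> measure lebesgue (ball t r - S) \<le> \<epsilon> * r"
        using d by blast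
    qed
  qed
qed

lemma set_integrable_bounded:
  fixes v :: "real \<Rightarrow> 'h::{banach,second_countable_topology}"
  assumes "v \<in> borel_measurable lebesgue" "\<And>s. norm (v s) \<le> K"
  shows "set_integrable lebesgue {a..b} v"
  unfolding set_integrable_def
proof (rule integrableI_bounded_set[where A="{a..b}" and B=K])
  show "emeasure lebesgue {a..b} < \<infinity>"
    using fmeasurableD2[of "{a..b}" lebesgue] by (simp add: less_top)
  show "(\<lambda>x. indicator {a..b} x *\<^sub>R v x) \<in> borel_measurable lebesgue"
    using assms(1) by (intro borel_measurable_scaleR borel_measurable_indicator) auto
qed (auto simp: assms(2) indicator_def intro!: AE_I2)

text \<open>Almost every \<open>t\<close> is a density point of each of the countably many sets
  \<open>{s. dist (v s) q < 1 / (n + 1)}\<close>, with \<open>q\<close> in a countable dense set, that contains it.\<close>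

lemma AE_lebesgue_point:
  fixes v :: "real \<Rightarrow> 'h::{banach,second_countable_topology}"
  assumes v: "v \<in> borel_measurable lebesgue" and K: "\<And>s. norm (v s) \<le> K"
  shows "AE t in lebesgue. t \<in> {0..T} \<longrightarrow> (\<forall>\<eta>>0. \<exists>d>0. \<forall>a b. 0 \<le> a \<and> a \<le> t \<and> t \<le> b \<and> b \<le> T \<and> b - a < d
           \<longrightarrow> norm ((LINT s:{a..b}|lebesgue. v s) - (b - a) *\<^sub>R v t) \<le> \<eta> * (b - a))"
proof -
  obtain Q :: "'h set" where Q: "countable Q" "\<And>X. open X \<Longrightarrow> X \<noteq> {} \<Longrightarrow> \<exists>q\<in>Q. q \<in> X"
    by (rule countable_dense_setE) blast
  have "K \<ge> 0" using K[of 0] norm_ge_zero order_trans by blast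
  define S where "S q n = {s \<in> {0..T}. dist (v s) q < inverse (real (Suc n))}" for q n
  have Sm: "S q n \<in> lmeasurable" for q n
  proof (rule bounded_set_imp_lmeasurable)
    show "bounded (S q n)" by (rule bounded_subset[of "{0..T}"]) (auto simp: S_def)
    have "S q n = {0..T} \<inter> (v -` ball q (inverse (real (Suc n))) \<inter> space lebesgue)"
      by (auto simp: S_def dist_commute)
    also have "\<dots> \<in> sets lebesgue" using v by (intro sets.Int measurable_sets[OF v]) auto
    finally show "S q n \<in> sets lebesgue" .
  qed
  have "AE t in lebesgue. \<forall>q\<in>Q. \<forall>n. t \<in> S q n \<longrightarrow>
     (\<forall>\<epsilon>>0. \<exists>d>0. \<forall>r. 0 < r \<and> r < d \<longrightarrow> measure lebesgue (ball t r - S q n) \<le> \<epsilon> * r)"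
    by (rule AE_ball_countable[OF Q(1), THEN iffD2], rule ballI, rule AE_all_countable[THEN iffD2],
        rule allI, rule AE_density_point[OF Sm])
  then show ?thesis
  proof eventually_elim
    case (elim t)
    show ?case
    proof (intro impI allI)
      fix \<eta> :: real assume t: "t \<in> {0..T}" and \<eta>: "\<eta> > 0"
      obtain n where n: "inverse (real (Suc n)) < \<eta> / 4" using reals_Archimedean[of "\<eta>/4"] \<eta> by auto
      obtain q where q: "q \<in> Q" "q \<in> ball (v t) (inverse (real (Suc n)))"
        using Q(2)[of "ball (v t) (inverse (real (Suc n)))"] by auto
      have tS: "t \<in> S q n" using q t by (auto simp: S_def)
      \<comment> \<open>With \<open>r = 2 * (b - a)\<close> below, the bad part contributes at most
        \<open>2 * K * (\<epsilon> * r)\<close>, which this choice keeps below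
        \<open>\<eta> / 2 * (b - a)\<close>. The summand 1 guards against
        \<open>K = 0\<close>.\<close>
      define \<epsilon> where "\<epsilon> = \<eta> / (8 * (K + 1))"
      have "\<epsilon> > 0" using \<eta> \<open>K \<ge> 0\<close> by (simp add: \<epsilon>_def)
      obtain d where d: "d > 0" "\<And>r. 0 < r \<Longrightarrow> r < d \<Longrightarrow> measure lebesgue (ball t r - S q n) \<le> \<epsilon> * r"
        using elim[rule_format, OF q(1) tS \<open>\<epsilon> > 0\<close>] by (elim exE conjE) simp
      show "\<exists>d>0. \<forall>a b. 0 \<le> a \<and> a \<le> t \<and> t \<le> b \<and> b \<le> T \<and> b - a < d
           \<longrightarrow> norm ((LINT s:{a..b}|lebesgue. v s) - (b - a) *\<^sub>R v t) \<le> \<eta> * (b - a)"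
      proof (intro exI[of _ "d/2"] conjI allI impI)
        show "d / 2 > 0" using d by simp
        fix a b assume ab: "0 \<le> a \<and> a \<le> t \<and> t \<le> b \<and> b \<le> T \<and> b - a < d / 2"
        show "norm ((LINT s:{a..b}|lebesgue. v s) - (b - a) *\<^sub>R v t) \<le> \<eta> * (b - a)"
        proof (cases "a = b")
          case True
          have "(LINT s:{a..b}|lebesgue. v s) = (LINT s::real|lebesgue. 0)"
            unfolding set_lebesgue_integral_def
          proof (rule integral_cong_AE)
            have "AE s in lebesgue. s \<noteq> b"
              using AE_not_in[of "{b}" lebesgue] by (simp add: negligible_iff_null_sets[symmetric])
            then show "AE s in lebesgue. indicator {a..b} s *\<^sub>R v s = 0"
              by eventually_elim (use True in \<open>auto simp: indicator_def\<close>)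
          qed (use v in \<open>auto intro!: borel_measurable_scaleR borel_measurable_indicator\<close>)
          then show ?thesis using True by simp
        next
          case False
          \<comment> \<open>Twice the length, so that the open ball about \<open>t\<close> contains
            both end points even if \<open>t\<close> is one of them. This is why the admissible
            length is \<open>d / 2\<close>.\<close>
          define r where "r = 2 * (b - a)"
          have r: "0 < r" "r < d" using False ab by (auto simp: r_def)
          have sub: "{a..b} - S q n \<subseteq> ball t r - S q n" using ab False by (auto simp: r_def dist_real_def)
          have m1: "{a..b} - S q n \<in> lmeasurable" using Sm by (intro fmeasurable_Diff) auto
          have m2: "ball t r - S q n \<in> lmeasurable" using Sm by (intro fmeasurable_Diff) auto
          have me: "measure lebesgue ({a..b} - S q n) \<le> \<epsilon> * r"
            using measure_mono_fmeasurable[OF sub _ m2] m1 d(2)[OF r] by (auto simp: fmeasurableD)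
          have intv: "set_integrable lebesgue {a..b} v" by (rule set_integrable_bounded[OF v K])
          have intc: "set_integrable lebesgue {a..b} (\<lambda>s. v t)"
            by (rule set_integrable_bounded[where K="norm (v t)"]) auto
          have "(b - a) *\<^sub>R v t = (LINT s:{a..b}|lebesgue. v t)"
            using ab by (simp add: set_lebesgue_integral_def)
          then have "(LINT s:{a..b}|lebesgue. v s) - (b - a) *\<^sub>R v t = (LINT s:{a..b}|lebesgue. v s - v t)"
            using set_integral_diff(2)[OF intv intc] by simp
          also have "norm \<dots> \<le> (LINT s:{a..b}|lebesgue. norm (v s - v t))"
            using set_integral_diff(1)[OF intv intc] by (rule set_integral_norm_bound)
          \<comment> \<open>On \<open>S q n\<close> both \<open>v s\<close> and \<open>v t\<close>
            are within \<open>\<eta> / 4\<close> of \<open>q\<close>; off it only the crude bound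
            \<open>2 * K\<close> is available, but on a set of small measure.\<close>
          also have "\<dots> \<le> (LINT s:{a..b}|lebesgue. \<eta> / 2 + 2 * K * indicator ({a..b} - S q n) s)"
          proof (rule set_integral_mono)
            show "set_integrable lebesgue {a..b} (\<lambda>s. norm (v s - v t))"
              using set_integral_diff(1)[OF intv intc] by (rule set_integrable_norm)
            show "set_integrable lebesgue {a..b} (\<lambda>s. \<eta> / 2 + 2 * K * indicator ({a..b} - S q n) s)"
              using \<eta> \<open>K \<ge> 0\<close> m1 by (intro set_integrable_bounded[where K="\<eta>/2 + 2 * K"] borel_measurable_add borel_measurable_times borel_measurable_indicator) (auto simp: indicator_def fmeasurableD)
            fix s assume s: "s \<in> {a..b}"
            show "norm (v s - v t) \<le> \<eta> / 2 + 2 * K * indicator ({a..b} - S q n) s"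
            proof (cases "s \<in> S q n")
              case True
              then have "dist (v s) q < \<eta>/4" "dist (v t) q < \<eta>/4" using n tS by (auto simp: S_def)
              then have "dist (v s) (v t) \<le> \<eta>/2" using dist_triangle2[of "v s" "v t" q] by linarith
              then show ?thesis using True by (simp add: dist_norm)
            next
              case False
              have "norm (v s - v t) \<le> 2 * K" using norm_triangle_ineq4[of "v s" "v t"] K[of s] K[of t] by linarith
              then show ?thesis using False s \<eta> by simp
            qed
          qed
          also have "\<dots> = \<eta> / 2 * (b - a) + 2 * K * measure lebesgue ({a..b} - S q n)"
          proof -
            have "(LINT s:{a..b}|lebesgue. \<eta> / 2 + 2 * K * indicator ({a..b} - S q n) s)
              = (LINT s|lebesgue. \<eta> / 2 * indicator {a..b} s + 2 * K * indicator ({a..b} - S q n) s)"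
              unfolding set_lebesgue_integral_def by (intro Bochner_Integration.integral_cong) (auto simp: indicator_def)
            also have "\<dots> = \<eta> / 2 * (b - a) + 2 * K * measure lebesgue ({a..b} - S q n)"
              using m1 ab by (subst Bochner_Integration.integral_add) (auto simp: lmeasurable_iff_integrable[symmetric] integrable_mult_left_iff lmeasure_integral fmeasurableD fmeasurableD2 less_top[symmetric])
            finally show ?thesis .
          qed
          also have "\<dots> \<le> \<eta> / 2 * (b - a) + 2 * K * (\<epsilon> * r)"
            using me \<open>K \<ge> 0\<close> by (intro add_left_mono mult_left_mono) auto
          also have "2 * K * (\<epsilon> * r) = \<eta> / 2 * (b - a) * (K / (K + 1))"
            using \<open>K \<ge> 0\<close> by (simp add: \<epsilon>_def r_def field_simps)
          also have "\<eta> / 2 * (b - a) * (K / (K + 1)) \<le> \<eta> / 2 * (b - a) * 1"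
            using ab \<eta> \<open>K \<ge> 0\<close> by (intro mult_left_mono) auto
          finally show ?thesis by (simp add: field_simps)
        qed
      qed
    qed
  qed
qed


section \<open>Functions of time in the Sobolev space\<close>

lemma W1_infI:
  fixes v :: "real \<Rightarrow> 'h::{banach,second_countable_topology}"
  assumes "v \<in> borel_measurable lebesgue" "\<And>s. nrm (v s) \<le> K"
    and "\<And>t. t \<in> {0..T} \<Longrightarrow> u t = u 0 + (LINT s:{0..t}|lebesgue. v s)"
  shows "W1_inf T nrm u"
  unfolding W1_inf_def
proof (intro exI[of _ v] conjI ballI assms(3))
  show "v \<in> borel_measurable (lebesgue_on {0..T})" by (rule measurable_restrict_space1[OF assms(1)])
  show "\<exists>K. AE t in lebesgue_on {0..T}. nrm (v t) \<le> K" using assms(2) by (intro exI[of _ K] AE_I2)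
qed

text \<open>The density is set to zero outside the interval and wherever it exceeds its essential
  bound. This alters no integral over \<open>{0..t}\<close> and makes it measurable on the line and
  bounded everywhere.\<close>

lemma W1_infE:
  fixes u :: "real \<Rightarrow> 'h::{banach,second_countable_topology}"
  assumes "W1_inf T norm u"
  obtains v K where "v \<in> borel_measurable lebesgue" "\<And>s. norm (v s) \<le> K"
    "\<forall>t\<in>{0..T}. u t = u 0 + (LINT s:{0..t}|lebesgue. v s)"
proof -
  obtain v K where v: "v \<in> borel_measurable (lebesgue_on {0..T})"
    "AE t in lebesgue_on {0..T}. norm (v t) \<le> K"
    "\<forall>t\<in>{0..T}. u t = u 0 + (LINT s:{0..t}|lebesgue. v s)"
    using assms unfolding W1_inf_def by blast
  define w where "w s = indicator {0..T} s *\<^sub>R v s" for s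
  define w' where "w' s = (if norm (w s) \<le> K then w s else 0)" for s
  have w: "w \<in> borel_measurable lebesgue"
    using v(1) unfolding w_def by (subst (asm) borel_measurable_restrict_space_iff) auto
  have w': "w' \<in> borel_measurable lebesgue"
    unfolding w'_def using w by measurable
  have ae: "AE t in lebesgue. t \<in> {0..T} \<longrightarrow> norm (v t) \<le> K"
    using v(2) by (subst (asm) AE_restrict_space_iff) auto
  show ?thesis
  proof
    show "w' \<in> borel_measurable lebesgue" by (rule w')
    \<comment> \<open>The maximum covers the default value 0, as the sign of \<open>K\<close> is not
      known.\<close>
    show "norm (w' s) \<le> max K 0" for s by (auto simp: w'_def)
  next
    show "\<forall>t\<in>{0..T}. u t = u 0 + (LINT s:{0..t}|lebesgue. w' s)"
    proof
      fix t assume t: "t \<in> {0..T}"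
      have "(LINT s:{0..t}|lebesgue. v s) = (LINT s:{0..t}|lebesgue. w s)"
        unfolding set_lebesgue_integral_def using t
        by (intro Bochner_Integration.integral_cong) (auto simp: w_def indicator_def)
      also have "\<dots> = (LINT s:{0..t}|lebesgue. w' s)"
        unfolding set_lebesgue_integral_def
      proof (rule integral_cong_AE)
        show "AE s in lebesgue. indicator {0..t} s *\<^sub>R w s = indicator {0..t} s *\<^sub>R w' s"
          using ae by eventually_elim (use t in \<open>auto simp: w'_def w_def indicator_def\<close>)
      qed (use w w' in \<open>auto intro!: borel_measurable_scaleR borel_measurable_indicator\<close>)
      finally show "u t = u 0 + (LINT s:{0..t}|lebesgue. w' s)" using bspec[OF v(3) t] by simp
    qed
  qed
qed

lemma W1_inf_cong:
  assumes "\<And>t. t \<in> {0..T} \<Longrightarrow> u t = w t" "T > 0"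
  shows "W1_inf T nrm u \<longleftrightarrow> W1_inf T nrm w"
  using assms unfolding W1_inf_def by auto

lemma W1_inf_norm_mono:
  assumes "W1_inf T nrm u" "0 \<le> M" "\<And>x. nrm' x \<le> M * nrm x"
  shows "W1_inf T nrm' u"
proof -
  obtain v K where v: "v \<in> borel_measurable (lebesgue_on {0..T})"
    "AE t in lebesgue_on {0..T}. nrm (v t) \<le> K"
    "\<forall>t\<in>{0..T}. u t = u 0 + (LINT s:{0..t}|lebesgue. v s)"
    using assms(1) unfolding W1_inf_def by blast
  have "AE t in lebesgue_on {0..T}. nrm' (v t) \<le> M * K"
    using v(2) by eventually_elim (meson assms(2,3) mult_left_mono order_trans)
  then show ?thesis unfolding W1_inf_def using v by blast
qed

text \<open>The Bochner integral commutes with bounded linear maps, so the image of the density is a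
  density of the image. It is applied to \<open>C\<close>, its inverse and
  \<open>op_G\<close>.\<close>

lemma W1_inf_bounded_linear:
  fixes u :: "real \<Rightarrow> 'h::{banach,second_countable_topology}"
    and L :: "'h \<Rightarrow> 'k::{banach,second_countable_topology}"
  assumes "W1_inf T norm u" and L: "bounded_linear L"
  shows "W1_inf T norm (\<lambda>t. L (u t))"
proof -
  interpret L: bounded_linear L by fact
  obtain v K where v: "v \<in> borel_measurable lebesgue" "\<And>s. norm (v s) \<le> K"
    "\<forall>t\<in>{0..T}. u t = u 0 + (LINT s:{0..t}|lebesgue. v s)"
    using W1_infE[OF assms(1)] by metis
  obtain B where B: "0 \<le> B" "\<And>x. norm (L x) \<le> norm x * B" using L.nonneg_bounded by blast
  show ?thesis
  proof (rule W1_infI)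
    show "(\<lambda>s. L (v s)) \<in> borel_measurable lebesgue"
      using v(1) by (rule borel_measurable_continuous_onI[OF L.continuous_on[OF continuous_on_id], THEN measurable_compose_rev])
    show "norm (L (v s)) \<le> K * B" for s
      using B v(2)[of s] by (meson mult_right_mono order_trans)
    fix t assume t: "t \<in> {0..T}"
    have "L (LINT s:{0..t}|lebesgue. v s) = (LINT s:{0..t}|lebesgue. L (v s))"
      using integral_bounded_linear[OF L, of lebesgue "\<lambda>s. indicator {0..t} s *\<^sub>R v s"] set_integrable_bounded[OF v(1,2), of 0 t]
      by (simp add: set_lebesgue_integral_def set_integrable_def L.scaleR)
    then show "L (u t) = L (u 0) + (LINT s:{0..t}|lebesgue. L (v s))"
      using bspec[OF v(3) t] by (simp add: L.add)
  qed
qed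

lemma W1_inf_add:
  fixes u w :: "real \<Rightarrow> 'h::{banach,second_countable_topology}"
  assumes "W1_inf T norm u" "W1_inf T norm w"
  shows "W1_inf T norm (\<lambda>t. u t + w t)"
proof -
  obtain v K where v: "v \<in> borel_measurable lebesgue" "\<And>s. norm (v s) \<le> K"
    "\<forall>t\<in>{0..T}. u t = u 0 + (LINT s:{0..t}|lebesgue. v s)"
    using W1_infE[OF assms(1)] by metis
  obtain v' K' where v': "v' \<in> borel_measurable lebesgue" "\<And>s. norm (v' s) \<le> K'"
    "\<forall>t\<in>{0..T}. w t = w 0 + (LINT s:{0..t}|lebesgue. v' s)"
    using W1_infE[OF assms(2)] by metis
  show ?thesis
  proof (rule W1_infI)
    show "(\<lambda>s. v s + v' s) \<in> borel_measurable lebesgue" using v(1) v'(1) by (rule borel_measurable_add)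
    show "norm (v s + v' s) \<le> K + K'" for s using v(2) v'(2) by (rule norm_add_rule_thm)
    fix t assume t: "t \<in> {0..T}"
    have "(LINT s:{0..t}|lebesgue. v s + v' s) = (LINT s:{0..t}|lebesgue. v s) + (LINT s:{0..t}|lebesgue. v' s)"
      by (intro set_integral_add set_integrable_bounded[OF v(1,2)] set_integrable_bounded[OF v'(1,2)])
    then show "u t + w t = u 0 + w 0 + (LINT s:{0..t}|lebesgue. v s + v' s)"
      using bspec[OF v(3) t] bspec[OF v'(3) t] by simp
  qed
qed

lemma W1_inf_diff:
  fixes u w :: "real \<Rightarrow> 'h::{banach,second_countable_topology}"
  assumes "W1_inf T norm u" "W1_inf T norm w"
  shows "W1_inf T norm (\<lambda>t. u t - w t)"
  using W1_inf_add[OF assms(1) W1_inf_bounded_linear[OF assms(2) bounded_linear_minus[OF bounded_linear_ident]]]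
  by simp

section \<open>Increments, derivatives and continuity of primitives\<close>

lemma primitive_increment:
  fixes v :: "real \<Rightarrow> 'h::{banach,second_countable_topology}"
  assumes v: "v \<in> borel_measurable lebesgue" "\<And>s. norm (v s) \<le> K"
    and u: "\<forall>t\<in>{0..T}. u t = u 0 + (LINT s:{0..t}|lebesgue. v s)"
    and ab: "0 \<le> a" "a \<le> b" "b \<le> T"
  shows "u b - u a = (LINT s:{a..b}|lebesgue. v s)"
proof -
  have "{0..b} = {0..a} \<union> {a..b}" using ab by auto
  moreover have "(LINT s:{0..a} \<union> {a..b}|lebesgue. v s) = (LINT s:{0..a}|lebesgue. v s) + (LINT s:{a..b}|lebesgue. v s)"
  proof (rule set_integral_Un_AE)
    have "AE s in lebesgue. s \<noteq> a"
      using AE_not_in[of "{a}" lebesgue] by (simp add: negligible_iff_null_sets[symmetric])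
    then show "AE s in lebesgue. \<not> (s \<in> {0..a} \<and> s \<in> {a..b})" by eventually_elim auto
  qed (auto intro!: set_integrable_bounded[OF v])
  ultimately show ?thesis using bspec[OF u, of a] bspec[OF u, of b] ab by simp
qed

text \<open>Every Lebesgue point is a point of differentiability: the estimate for intervals
  containing \<open>t\<close> is used with \<open>t\<close> as left or right end point, which treats
  the two one-sided quotients.\<close>

lemma primitive_AE_has_vector_derivative:
  fixes v :: "real \<Rightarrow> 'h::{banach,second_countable_topology}"
  assumes v: "v \<in> borel_measurable lebesgue" "\<And>s. norm (v s) \<le> K"
    and u: "\<forall>t\<in>{0..T}. u t = u 0 + (LINT s:{0..t}|lebesgue. v s)"
  shows "AE t in lebesgue_on {0..T}. (u has_vector_derivative v t) (at t within {0..T})"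
proof -
  have "AE t in lebesgue. t \<in> {0..T} \<longrightarrow> (u has_vector_derivative v t) (at t within {0..T})"
    using AE_lebesgue_point[OF v, of T]
  proof eventually_elim
    case (elim t)
    show ?case
      unfolding has_vector_derivative_def has_derivative_within_alt
    proof (intro impI conjI allI bounded_linear_scaleR_left)
      fix \<eta> :: real assume t: "t \<in> {0..T}" and "\<eta> > 0"
      then obtain d where d: "d > 0" "\<And>a b. 0 \<le> a \<Longrightarrow> a \<le> t \<Longrightarrow> t \<le> b \<Longrightarrow> b \<le> T \<Longrightarrow> b - a < d \<Longrightarrow>
          norm ((LINT s:{a..b}|lebesgue. v s) - (b - a) *\<^sub>R v t) \<le> \<eta> * (b - a)"
        using elim by meson
      have "norm (u y - u t - (y - t) *\<^sub>R v t) \<le> \<eta> * norm (y - t)" if y: "y \<in> {0..T}" "norm (y - t) < d" for y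
      proof (cases "t \<le> y")
        case True
        then show ?thesis
          using d(2)[of t y] t y primitive_increment[where u=u and v=v and a=t and b=y, OF v u] by simp
      next
        case False
        have "u y - u t - (y - t) *\<^sub>R v t = - ((u t - u y) - (t - y) *\<^sub>R v t)" by (simp add: algebra_simps)
        then have "norm (u y - u t - (y - t) *\<^sub>R v t) = norm ((u t - u y) - (t - y) *\<^sub>R v t)"
          by (simp only: norm_minus_cancel)
        then show ?thesis
          using d(2)[of y t] False t y primitive_increment[where u=u and v=v and a=y and b=t, OF v u] by simp
      qed
      then show "\<exists>d>0. \<forall>y\<in>{0..T}. norm (y - t) < d \<longrightarrow> norm (u y - u t - (y - t) *\<^sub>R v t) \<le> \<eta> * norm (y - t)"
        using d(1) by blast
    qed
  qed
  then show ?thesis by (subst AE_restrict_space_iff) auto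
qed

lemma has_ddt_iff: "has_ddt T u t \<longleftrightarrow> (u has_vector_derivative ddt T u t) (at t within {0..T})"
  unfolding has_ddt_def ddt_def by (rule vector_derivative_works)

text \<open>Since \<open>T > 0\<close>, the interval is nondegenerate and derivatives within it are
  unique, at its end points too.\<close>

lemma ddt_eqI:
  assumes "T > 0" "t \<in> {0..T}" "(u has_vector_derivative D) (at t within {0..T})"
  shows "has_ddt T u t" "ddt T u t = D"
proof -
  show "has_ddt T u t"
    using assms(3) by (auto simp: has_ddt_def intro: differentiableI_vector)
  show "ddt T u t = D"
    using vector_derivative_within_cbox[of 0 T t u D] assms by (simp add: ddt_def)
qed

lemma W1_inf_AE_has_ddt:
  fixes u :: "real \<Rightarrow> 'h::{banach,second_countable_topology}"
  assumes "W1_inf T norm u"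
  shows "AE t in lebesgue_on {0..T}. has_ddt T u t"
proof -
  obtain v K where v: "v \<in> borel_measurable lebesgue" "\<And>s. norm (v s) \<le> K"
    "\<forall>t\<in>{0..T}. u t = u 0 + (LINT s:{0..t}|lebesgue. v s)"
    using W1_infE[OF assms(1)] by metis
  from primitive_AE_has_vector_derivative[where u=u and v=v and T=T, OF v]
  show ?thesis by eventually_elim (auto simp: has_ddt_def intro: differentiableI_vector)
qed

lemma AE_time: "AE t in lebesgue_on {0..T::real}. t \<in> {0..T}"
  using AE_space[of "lebesgue_on {0..T}"] by simp

text \<open>The density agrees with the derivative almost everywhere, and the inner product with
  \<open>p\<close> passes under the integral. This recovers a constraint at all times from its
  initial and rate forms.\<close>

lemma W1_inf_orthogonal:
  fixes u :: "real \<Rightarrow> 'h::{real_inner,banach,second_countable_topology}"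
  assumes "T > 0" "W1_inf T norm u" "inner (u 0) p = 0"
    and "AE t in lebesgue_on {0..T}. inner (ddt T u t) p = 0" and t: "t \<in> {0..T}"
  shows "inner (u t) p = 0"
proof -
  obtain v K where v: "v \<in> borel_measurable lebesgue" "\<And>s. norm (v s) \<le> K"
    "\<forall>t\<in>{0..T}. u t = u 0 + (LINT s:{0..t}|lebesgue. v s)"
    using W1_infE[OF assms(2)] by metis
  have "AE t in lebesgue_on {0..T}. inner (v t) p = 0"
    using primitive_AE_has_vector_derivative[where u=u and v=v and T=T, OF v] assms(4) AE_time
    by eventually_elim (metis assms(1) ddt_eqI(2))
  then have ae: "AE t in lebesgue. t \<in> {0..T} \<longrightarrow> inner (v t) p = 0"
    by (subst (asm) AE_restrict_space_iff) auto
  have int: "integrable lebesgue (\<lambda>s. indicator {0..t} s *\<^sub>R v s)"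
    using set_integrable_bounded[OF v(1,2), of 0 t] by (simp add: set_integrable_def)
  then have "inner (LINT s:{0..t}|lebesgue. v s) p = (LINT s|lebesgue. inner (indicator {0..t} s *\<^sub>R v s) p)"
    by (subst integral_inner_left) (auto simp: set_lebesgue_integral_def)
  also have "\<dots> = 0"
    by (rule integral_eq_zero_AE) (use ae in \<open>eventually_elim, use t in \<open>auto simp: indicator_def\<close>\<close>)
  finally show ?thesis using bspec[OF v(3) t] assms(3) by (simp add: inner_add_left)
qed

text \<open>A bound for the density is a Lipschitz constant of the primitive.\<close>

lemma W1_inf_continuous_on:
  fixes u :: "real \<Rightarrow> 'h::{banach,second_countable_topology}"
  assumes "W1_inf T norm u"
  shows "continuous_on {0..T} u"
proof -
  obtain v K where v: "v \<in> borel_measurable lebesgue" "\<And>s. norm (v s) \<le> K"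
    "\<forall>t\<in>{0..T}. u t = u 0 + (LINT s:{0..t}|lebesgue. v s)"
    using W1_infE[OF assms(1)] by metis
  have "0 \<le> K" using v(2)[of 0] norm_ge_zero order_trans by blast
  have le: "norm (u b - u a) \<le> K * (b - a)" if ab: "0 \<le> a" "a \<le> b" "b \<le> T" for a b
  proof -
    have "u b - u a = (LINT s:{a..b}|lebesgue. v s)"
      by (rule primitive_increment[where u=u and v=v, OF v ab])
    also have "norm \<dots> \<le> (LINT s:{a..b}|lebesgue. norm (v s))"
      by (rule set_integral_norm_bound[OF set_integrable_bounded[OF v(1,2)]])
    also have "\<dots> \<le> (LINT s:{a..b}|lebesgue. K)"
      using v(2) by (intro set_integral_mono set_integrable_norm set_integrable_bounded[OF v(1,2)] set_integrable_bounded[where K="\<bar>K\<bar>"]) auto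
    also have "\<dots> = K * (b - a)" using ab by (simp add: set_lebesgue_integral_def)
    finally show ?thesis .
  qed
  have "K-lipschitz_on {0..T} u"
  proof (rule lipschitz_onI)
    fix x y assume "x \<in> {0..T}" "y \<in> {0..T}"
    then show "dist (u x) (u y) \<le> K * dist x y"
      using le[of x y] le[of y x]
      by (cases "x \<le> y") (auto simp: dist_norm norm_minus_commute)
  qed fact
  then show ?thesis by (rule lipschitz_on_continuous_on)
qed

text \<open>The exceptional times in the open interval form an open null set, hence none exist; the
  end points follow by taking the closure.\<close>

lemma continuous_AE_closed:
  fixes u :: "real \<Rightarrow> 'h::real_normed_vector"
  assumes "T > 0" "continuous_on {0..T} u" "closed S" "AE t in lebesgue_on {0..T}. u t \<in> S" "t \<in> {0..T}"
  shows "u t \<in> S"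
proof -
  let ?D = "{0<..<T} \<inter> u -` (- S)"
  have cont: "continuous_on {0<..<T} u" by (rule continuous_on_subset[OF assms(2)]) auto
  have "open ?D"
    by (rule continuous_open_preimage[OF cont]) (use assms(3) in auto)
  moreover have "negligible ?D"
  proof -
    have "AE t in lebesgue. t \<in> {0..T} \<longrightarrow> u t \<in> S"
      using assms(4) by (subst (asm) AE_restrict_space_iff) auto
    then obtain N where N: "N \<in> null_sets lebesgue" "{t. \<not> (t \<in> {0..T} \<longrightarrow> u t \<in> S)} \<subseteq> N"
      by (auto elim: AE_E3 simp: eventually_ae_filter)
    have "?D \<subseteq> N" using N(2) by auto
    then show ?thesis using N(1) negligible_subset negligible_iff_null_sets by blast
  qed
  ultimately have "?D = {}" using open_not_negligible by blast
  then have "{0<..<T} \<subseteq> {0..T} \<inter> u -` S" by auto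
  moreover have "closed ({0..T} \<inter> u -` S)"
    by (rule continuous_closed_preimage[OF assms(2)]) (use assms(3) in auto)
  ultimately have "closure {0<..<T} \<subseteq> {0..T} \<inter> u -` S" by (rule closure_minimal)
  then show ?thesis using assms(1,5) by auto
qed

section \<open>Closed operators and their adjoints\<close>

text \<open>The solution minimises \<open>inner (C h) h - 2 * inner x h\<close> on \<open>R\<close>; by the parallelogram identity, minimising
  sequences are Cauchy.\<close>

lemma symmetric_coercive_solution:
  fixes C :: "'h::{real_inner,banach} \<Rightarrow> 'h"
  assumes C: "bounded_linear C" and sym: "\<And>a b. inner (C a) b = inner a (C b)"
    and c0: "c0 > 0" and coer: "\<And>a. inner (C a) a \<ge> c0 * (norm a)\<^sup>2"
    and R: "subspace R" "closed R"
  shows "\<exists>h\<in>R. \<forall>r\<in>R. inner (C h) r = inner x r"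
proof -
  interpret C: bounded_linear C by fact
  define q where "q h = inner (C h) h - 2 * inner x h" for h
  \<comment> \<open>Coercivity and Cauchy-Schwarz leave a quadratic in \<open>norm h\<close>,
    bounded below by completing the square.\<close>
  have lower: "- (norm x)\<^sup>2 / c0 \<le> q h" for h
  proof -
    have "inner x h \<le> norm x * norm h" by (rule norm_cauchy_schwarz)
    then have "c0 * (norm h)\<^sup>2 - 2 * (norm x * norm h) \<le> q h"
      using coer[of h] by (simp add: q_def)
    moreover have "0 \<le> (c0 * norm h - norm x)\<^sup>2 / c0" using c0 by simp
    then have "- (norm x)\<^sup>2 / c0 \<le> c0 * (norm h)\<^sup>2 - 2 * (norm x * norm h)"
      using c0 by (simp add: field_simps power2_eq_square)
    ultimately show ?thesis by linarith
  qed
  define d where "d = Inf (q ` R)"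
  have R0: "0 \<in> R" using R(1) by (rule subspace_0)
  have bdd: "bdd_below (q ` R)" by (intro bdd_belowI2[of R "- (norm x)\<^sup>2 / c0" q] lower)
  have dle: "d \<le> q h" if "h \<in> R" for h unfolding d_def using bdd that by (intro cInf_lower) auto
  have "\<exists>h\<in>R. q h < d + inverse (real (Suc n))" for n
  proof -
    have "Inf (q ` R) < d + inverse (real (Suc n))" unfolding d_def by simp
    then show ?thesis using R0 bdd by (subst (asm) cInf_less_iff) auto
  qed
  then obtain h where h: "\<And>n. h n \<in> R" "\<And>n. q (h n) < d + inverse (real (Suc n))" by metis
  \<comment> \<open>The midpoint of \<open>a\<close> and \<open>b\<close> lies in \<open>R\<close>,
    so its value is at least \<open>d\<close>; the parallelogram identity then controls the distance
    by the excess over the infimum.\<close>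
  have par: "c0 / 4 * (norm (a - b))\<^sup>2 \<le> (q a + q b) / 2 - d" if "a \<in> R" "b \<in> R" for a b
  proof -
    have "q ((1/2) *\<^sub>R (a + b)) = (q a + q b) / 2 - inner (C (a - b)) (a - b) / 4"
      using sym[of b a] by (simp add: q_def C.add C.diff C.scaleR inner_add_left inner_add_right
        inner_diff_left inner_diff_right inner_commute field_simps)
    moreover have "d \<le> q ((1/2) *\<^sub>R (a + b))"
      using that R(1) by (intro dle subspace_scale subspace_add)
    ultimately show ?thesis using coer[of "a - b"] by linarith
  qed
  have "Cauchy h"
  proof (rule metric_CauchyI)
    fix e :: real assume e: "e > 0"
    then have "c0 / 4 * e\<^sup>2 > 0" using c0 by simp
    then obtain N where N: "inverse (real (Suc N)) < c0 / 4 * e\<^sup>2" using reals_Archimedean by blast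
    have "dist (h m) (h n) < e" if "N \<le> m" "N \<le> n" for m n
    proof -
      have "inverse (real (Suc m)) \<le> inverse (real (Suc N))" "inverse (real (Suc n)) \<le> inverse (real (Suc N))"
        using that by (auto intro!: le_imp_inverse_le)
      then have "c0 / 4 * (norm (h m - h n))\<^sup>2 < c0 / 4 * e\<^sup>2"
        using par[OF h(1)[of m] h(1)[of n]] h(2)[of m] h(2)[of n] N by argo
      then have "(norm (h m - h n))\<^sup>2 < e\<^sup>2" using c0 by simp
      then show ?thesis using e by (simp add: dist_norm power2_less_imp_less)
    qed
    then show "\<exists>M. \<forall>m\<ge>M. \<forall>n\<ge>M. dist (h m) (h n) < e" by blast
  qed
  then obtain l where l: "h \<longlonglongrightarrow> l" using Cauchy_convergent convergent_def by blast
  have lR: "l \<in> R" using R(2) h(1) l by (rule closed_sequentially)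
  have ql: "(\<lambda>n. q (h n)) \<longlonglongrightarrow> q l"
    unfolding q_def using l by (intro tendsto_intros C.tendsto)
  have "(\<lambda>n. q (h n)) \<longlonglongrightarrow> d"
  proof (rule real_tendsto_sandwich)
    show "(\<lambda>n. d) \<longlonglongrightarrow> d" by simp
    show "(\<lambda>n. d + inverse (real (Suc n))) \<longlonglongrightarrow> d"
      using tendsto_add[OF tendsto_const LIMSEQ_inverse_real_of_nat, of d] by simp
  qed (use h dle in \<open>auto intro!: always_eventually less_imp_le\<close>)
  then have qd: "q l = d" using ql LIMSEQ_unique by blast
  have "inner (C l) r = inner x r" if r: "r \<in> R" for r
  proof (rule ccontr)
    define b where "b = inner (C l) r - inner x r"
    define a where "a = inner (C r) r"
    assume "inner (C l) r \<noteq> inner x r"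
    then have b: "b \<noteq> 0" by (simp add: b_def)
    have a: "a \<ge> 0" using coer[of r] c0 unfolding a_def by (meson mult_nonneg_nonneg less_imp_le order_trans zero_le_power2)
    \<comment> \<open>A step towards smaller values: it changes \<open>q\<close> by
      \<open>- (b\<^sup>2 * (a + 2) / (a + 1)\<^sup>2)\<close>, contradicting minimality. Using
      \<open>a + 1\<close> avoids division by zero.\<close>
    define s where "s = - b / (a + 1)"
    have "l + s *\<^sub>R r \<in> R" using lR r R(1) by (intro subspace_add subspace_scale)
    then have "d \<le> q (l + s *\<^sub>R r)" by (rule dle)
    also have "\<dots> = d + 2 * s * b + s\<^sup>2 * a"
      unfolding qd[symmetric] using sym[of r l] by (simp add: q_def a_def b_def C.add C.scaleR inner_add_left inner_add_right
        inner_commute power2_eq_square algebra_simps)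
    finally have "0 \<le> 2 * s * b + s\<^sup>2 * a" by simp
    also have "\<dots> = - (b\<^sup>2 * (a + 2) / (a + 1)\<^sup>2)"
      using a by (simp add: s_def divide_simps power2_eq_square) algebra
    finally show False using a b by (simp add: divide_le_0_iff mult_le_0_iff not_le)
  qed
  then show ?thesis using lR by blast
qed

section \<open>Linear operators on a subspace and bounded preimages\<close>

lemma
  assumes "linear_on_subspace W A"
  shows linear_on_subspace_subspace: "subspace W"
    and linear_on_subspace_add: "x \<in> W \<Longrightarrow> y \<in> W \<Longrightarrow> A (x + y) = A x + A y"
    and linear_on_subspace_scale: "x \<in> W \<Longrightarrow> A (c *\<^sub>R x) = c *\<^sub>R A x"
    and linear_on_subspace_0: "A 0 = 0"
    and linear_on_subspace_diff: "x \<in> W \<Longrightarrow> y \<in> W \<Longrightarrow> A (x - y) = A x - A y"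
proof -
  show W: "subspace W" and ad: "\<And>x y. x \<in> W \<Longrightarrow> y \<in> W \<Longrightarrow> A (x + y) = A x + A y"
    and sc: "\<And>c x. x \<in> W \<Longrightarrow> A (c *\<^sub>R x) = c *\<^sub>R A x"
    using assms by (auto simp: linear_on_subspace_def)
  show "A 0 = 0" using sc[of 0 0] subspace_0[OF W] by simp
  show "A (x - y) = A x - A y" if "x \<in> W" "y \<in> W"
    using ad[OF that(1) subspace_neg[OF W that(2)]] sc[OF that(2), of "-1"] by simp
qed

lemma linear_on_subspace_image:
  assumes "linear_on_subspace W A"
  shows "subspace (A ` W)"
  unfolding subspace_def
proof (intro conjI ballI allI)
  note W = linear_on_subspace_subspace[OF assms]
  show "0 \<in> A ` W" using linear_on_subspace_0[OF assms] subspace_0[OF W] by force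
  fix x assume x: "x \<in> A ` W"
  then obtain a where a: "a \<in> W" "x = A a" by blast
  then show "c *\<^sub>R x \<in> A ` W" for c
    using subspace_scale[OF W a(1)] by (simp flip: linear_on_subspace_scale[OF assms a(1)])
  fix y assume "y \<in> A ` W"
  then obtain b where b: "b \<in> W" "y = A b" by blast
  then show "x + y \<in> A ` W"
    using a subspace_add[OF W a(1) b(1)] by (simp flip: linear_on_subspace_add[OF assms a(1) b(1)])
qed

lemma subspace_closure:
  fixes W :: "'a::real_normed_vector set"
  assumes "subspace W"
  shows "subspace (closure W)"
  unfolding subspace_def
proof (intro conjI ballI allI)
  show "0 \<in> closure W" using subspace_0[OF assms] closure_subset by blast
  fix x assume "x \<in> closure W"
  then obtain a where a: "\<And>n. a n \<in> W" "a \<longlonglongrightarrow> x" using closure_sequential by metis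
  show "c *\<^sub>R x \<in> closure W" for c
    unfolding closure_sequential
  proof (intro exI[of _ "\<lambda>n. c *\<^sub>R a n"] conjI allI)
    show "(\<lambda>n. c *\<^sub>R a n) \<longlonglongrightarrow> c *\<^sub>R x" using a(2) by (intro tendsto_intros)
  qed (rule subspace_scale[OF assms a(1)])
  fix y assume "y \<in> closure W"
  then obtain b where b: "\<And>n. b n \<in> W" "b \<longlonglongrightarrow> y" using closure_sequential by metis
  show "x + y \<in> closure W"
    unfolding closure_sequential
  proof (intro exI[of _ "\<lambda>n. a n + b n"] conjI allI)
    show "(\<lambda>n. a n + b n) \<longlonglongrightarrow> x + y" using a(2) b(2) by (rule tendsto_add)
  qed (rule subspace_add[OF assms a(1) b(1)])
qed

text \<open>The open mapping theorem for an operator defined on a subspace only: the Baire property of the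
  range gives approximate preimages, which are corrected along a geometric series.\<close>

lemma closed_operator_bounded_preimage:
  fixes E :: "'x::banach \<Rightarrow> 'h::banach"
  assumes lin: "linear_on_subspace W E" and graph: "closed ((\<lambda>e. (e, E e)) ` W)" and range: "closed (E ` W)"
  obtains K where "0 \<le> K" "\<And>h. h \<in> E ` W \<Longrightarrow> \<exists>e\<in>W. E e = h \<and> norm e \<le> K * norm h"
proof -
  note W = linear_on_subspace_subspace[OF lin]
  note E_add = linear_on_subspace_add[OF lin] and E_diff = linear_on_subspace_diff[OF lin]
    and E_scale = linear_on_subspace_scale[OF lin] and E_0 = linear_on_subspace_0[OF lin]
  define R where "R = E ` W"
  have R: "subspace R" "closed R" using linear_on_subspace_image[OF lin] range by (auto simp: R_def)
  define F where "F n = closure (E ` {e \<in> W. norm e \<le> real n})" for n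
  have FR: "F n \<subseteq> R" for n unfolding F_def by (rule closure_minimal) (use R in \<open>auto simp: R_def\<close>)
  have UF: "(\<Union>n. F n) = R"
  proof (intro equalityI subsetI)
    fix y assume "y \<in> R"
    then obtain e where e: "e \<in> W" "y = E e" by (auto simp: R_def)
    obtain n where "norm e \<le> real n" using real_arch_simple by blast
    then have "y \<in> F n" unfolding F_def using e by (intro subsetD[OF closure_subset]) auto
    then show "y \<in> (\<Union>n. F n)" by blast
  qed (use FR in blast)
  \<comment> \<open>\<open>R\<close> is closed, hence completely metrizable, and is the union of the
    closed sets \<open>F n\<close>. Interiors are taken relative to \<open>R\<close>, which may be a
    proper subspace.\<close>
  have "\<exists>n. top_of_set R interior_of F n \<noteq> {}"
  proof (rule ccontr)
    assume "\<not> ?thesis"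
    then have "top_of_set R interior_of \<Union>(range F) = {}"
      using R(2) FR
      by (intro Baire_category_alt disjI1 completely_metrizable_space_closedin[OF completely_metrizable_space_euclidean])
         (auto simp: F_def closedin_closed_eq)
    moreover have "top_of_set R interior_of R = R" by (metis interior_of_topspace topspace_euclidean_subtopology)
    ultimately show False using UF subspace_0[OF R(1)] by auto
  qed
  then obtain n z where z: "z \<in> top_of_set R interior_of F n" by blast
  then obtain S where S: "openin (top_of_set R) S" "z \<in> S" "S \<subseteq> F n" by (auto simp: interior_of_def)
  then have zR: "z \<in> R" using openin_imp_subset by blast
  obtain r where r: "r > 0" "ball z r \<inter> R \<subseteq> F n"
    using S unfolding openin_contains_ball by (meson order_trans)
  \<comment> \<open>Both \<open>z + y\<close> and \<open>z - y\<close> lie in the relative ball; in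
    half the difference of their approximate preimages the centre \<open>z\<close> cancels.\<close>
  have approx: "\<exists>e\<in>W. norm e \<le> real n \<and> norm (y - E e) < \<delta>" if y: "y \<in> R" "norm y < r" and \<delta>: "\<delta> > 0" for y \<delta>
  proof -
    have "z + y \<in> F n" "z - y \<in> F n"
      using r y zR R(1) by (auto simp: dist_norm subspace_add subspace_diff intro!: subsetD[OF r(2)])
    then obtain e1 e2 where e: "e1 \<in> W" "norm e1 \<le> real n" "norm (E e1 - (z + y)) < \<delta>"
      "e2 \<in> W" "norm e2 \<le> real n" "norm (E e2 - (z - y)) < \<delta>"
      using \<delta> unfolding F_def closure_approachable dist_norm by blast
    let ?e = "(1/2) *\<^sub>R (e1 - e2)"
    have "norm ?e \<le> real n" using e(2,5) norm_triangle_ineq4[of e1 e2] by simp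
    moreover have "E e1 - E e2 = 2 *\<^sub>R E ?e"
      using e(1,4) W by (simp add: E_scale E_diff subspace_diff)
    then have "2 *\<^sub>R (y - E ?e) = (E e2 - (z - y)) - (E e1 - (z + y))"
      by (simp add: scaleR_2 algebra_simps)
    then have "2 * norm (y - E ?e) = norm ((E e2 - (z - y)) - (E e1 - (z + y)))"
      by (metis abs_numeral norm_scaleR)
    then have "norm (y - E ?e) < \<delta>"
      using e(3,6) norm_triangle_ineq4[of "E e2 - (z - y)" "E e1 - (z + y)"] by linarith
    moreover have "?e \<in> W" using e W by (intro subspace_scale subspace_diff)
    ultimately show ?thesis by blast
  qed
  define M where "M = 2 * real n / r"
  have M: "0 \<le> M" using r by (simp add: M_def)
  \<comment> \<open>Placing the existential outside the implication lets a total choice function be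
    extracted; 0 serves for \<open>y = 0\<close> and outside \<open>R\<close>.\<close>
  have "\<exists>e. y \<in> R \<longrightarrow> e \<in> W \<and> norm e \<le> M * norm y \<and> norm (y - E e) \<le> norm y / 2" for y
  proof (cases "y \<in> R \<and> y \<noteq> 0")
    case True
    \<comment> \<open>Dividing by \<open>k\<close> brings \<open>y\<close> to norm
      \<open>r / 2\<close>, inside the ball; scaling back turns the accuracy \<open>r / 4\<close>
      into \<open>norm y / 2\<close>.\<close>
    define k where "k = 2 * norm y / r"
    have k: "k > 0" using True r by (simp add: k_def)
    have y': "inverse k *\<^sub>R y \<in> R" "norm (inverse k *\<^sub>R y) < r"
      using True R(1) r k by (auto simp: subspace_scale k_def)
    obtain e where e: "e \<in> W" "norm e \<le> real n" "norm (inverse k *\<^sub>R y - E e) < r / 4"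
      using approx[OF y', of "r/4"] r by auto
    have "y - E (k *\<^sub>R e) = k *\<^sub>R (inverse k *\<^sub>R y - E e)"
      using k e by (simp add: E_scale algebra_simps)
    then have "norm (y - E (k *\<^sub>R e)) = k * norm (inverse k *\<^sub>R y - E e)" using k by simp
    also have "\<dots> \<le> k * (r / 4)" using e(3) k by (intro mult_left_mono) auto
    also have "\<dots> = norm y / 2" using r by (simp add: k_def)
    finally have "norm (y - E (k *\<^sub>R e)) \<le> norm y / 2" .
    moreover have "norm (k *\<^sub>R e) \<le> M * norm y"
    proof -
      have "norm (k *\<^sub>R e) \<le> k * real n" using k e(2) by simp
      also have "\<dots> = M * norm y" by (simp add: k_def M_def)
      finally show ?thesis .
    qed
    moreover have "k *\<^sub>R e \<in> W" using e W by (intro subspace_scale)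
    ultimately show ?thesis by blast
  next
    case False
    then show ?thesis using subspace_0[OF W] E_0 by (intro exI[of _ 0]) auto
  qed
  then obtain \<phi> where \<phi>: "\<And>y. y \<in> R \<Longrightarrow> \<phi> y \<in> W" "\<And>y. y \<in> R \<Longrightarrow> norm (\<phi> y) \<le> M * norm y"
    "\<And>y. y \<in> R \<Longrightarrow> norm (y - E (\<phi> y)) \<le> norm y / 2" by metis
  show ?thesis
  proof
    show "0 \<le> 2 * M" using M by simp
    fix h assume "h \<in> E ` W"
    then have h: "h \<in> R" by (simp add: R_def)
    \<comment> \<open>The residual left after \<open>k\<close> corrections; its norm at least halves
      each time.\<close>
    define y where "y = rec_nat h (\<lambda>_ y. y - E (\<phi> y))"
    have y0: "y 0 = h" and yS: "y (Suc k) = y k - E (\<phi> (y k))" for k by (simp_all add: y_def)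
    have yR: "y k \<in> R" for k
      by (induction k) (use h \<phi>(1) R(1) in \<open>auto simp: y0 yS R_def intro!: subspace_diff\<close>)
    have yn: "norm (y k) \<le> norm h * (1/2) ^ k" for k
    proof (induction k)
      case (Suc k)
      then show ?case using \<phi>(3)[OF yR[of k]] by (simp add: yS)
    qed (simp add: y0)
    define e where "e k = \<phi> (y k)" for k
    have eW: "e k \<in> W" for k using \<phi>(1) yR by (simp add: e_def)
    have en: "norm (e k) \<le> (M * norm h) * (1/2) ^ k" for k
    proof -
      have "norm (e k) \<le> M * norm (y k)" using \<phi>(2) yR by (simp add: e_def)
      also have "\<dots> \<le> M * (norm h * (1/2) ^ k)" using yn M by (rule mult_left_mono)
      finally show ?thesis by (simp only: mult.assoc)
    qed
    have geo: "(\<lambda>k. (M * norm h) * (1/2) ^ k) sums ((M * norm h) * 2)"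
      using geometric_sums[of "1/2::real"] by (intro sums_mult) simp
    have sn: "summable (\<lambda>k. norm (e k))"
      by (rule summable_comparison_test'[OF sums_summable[OF geo], of 0]) (use en in auto)
    then have se: "(\<lambda>k. \<Sum>i<k. e i) \<longlonglongrightarrow> suminf e"
      using summable_norm_cancel summable_LIMSEQ by blast
    have sW: "(\<Sum>i<k. e i) \<in> W" for k using eW W by (intro subspace_sum)
    have Es: "E (\<Sum>i<k. e i) = h - y k" for k
    proof (induction k)
      case (Suc k)
      then show ?case using E_add[OF sW eW, of k k] by (simp add: yS e_def)
    qed (simp add: E_0 y0)
    have "y \<longlonglongrightarrow> 0"
    proof (rule Lim_null_comparison)
      show "\<forall>\<^sub>F k in sequentially. norm (y k) \<le> norm h * (1/2) ^ k" using yn by simp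
      show "(\<lambda>k. norm h * (1/2) ^ k) \<longlonglongrightarrow> 0"
        by (rule tendsto_mult_right_zero) (rule LIMSEQ_realpow_zero, auto)
    qed
    then have "(\<lambda>k. E (\<Sum>i<k. e i)) \<longlonglongrightarrow> h"
      unfolding Es using tendsto_diff[OF tendsto_const, of y 0 sequentially h] by simp
    with se have lim: "(\<lambda>k. ((\<Sum>i<k. e i), E (\<Sum>i<k. e i))) \<longlonglongrightarrow> (suminf e, h)"
      by (rule tendsto_Pair)
    \<comment> \<open>The partial sums and their images both converge, so the closed graph puts the
      limit pair on the graph.\<close>
    have "(suminf e, h) \<in> (\<lambda>e. (e, E e)) ` W"
      by (rule closed_sequentially[OF graph _ lim]) (use sW in blast)
    then have "suminf e \<in> W" "E (suminf e) = h" by auto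
    moreover have "norm (suminf e) \<le> 2 * M * norm h"
    proof -
      have "norm (suminf e) \<le> (\<Sum>k. norm (e k))" using sn by (rule summable_norm)
      also have "\<dots> \<le> (M * norm h) * 2"
        using suminf_le[OF en sn sums_summable[OF geo]] sums_unique[OF geo] by simp
      finally show ?thesis by (simp add: mult_ac)
    qed
    ultimately show "\<exists>e\<in>W. E e = h \<and> norm e \<le> 2 * M * norm h" by blast
  qed
qed

section \<open>Functionals on the closure and the adjoint\<close>

text \<open>A bounded linear functional is Lipschitz, so it extends continuously to the closure;
  linearity and the bound pass to limits of sequences. The final \<open>restrict\<close> supplies
  the extensionality demanded by \<open>dual_of\<close>.\<close>

lemma subspace_functional_extension:
  fixes \<phi> :: "'x::real_normed_vector \<Rightarrow> real"
  assumes lin: "linear_on_subspace W \<phi>" and bd: "\<And>x. x \<in> W \<Longrightarrow> \<bar>\<phi> x\<bar> \<le> K * norm x"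
  obtains \<psi> where "\<psi> \<in> dual_of (closure W)" "\<And>x. x \<in> W \<Longrightarrow> \<psi> x = \<phi> x"
proof -
  note W = linear_on_subspace_subspace[OF lin]
  have lip: "\<bar>K\<bar>-lipschitz_on W \<phi>"
  proof (rule lipschitz_onI)
    fix x y assume xy: "x \<in> W" "y \<in> W"
    have "dist (\<phi> x) (\<phi> y) = \<bar>\<phi> (x - y)\<bar>"
      using linear_on_subspace_diff[OF lin xy] by (simp add: dist_norm)
    also have "\<dots> \<le> K * norm (x - y)" using xy W by (intro bd subspace_diff)
    also have "\<dots> \<le> \<bar>K\<bar> * dist x y" by (simp add: dist_norm mult_right_mono)
    finally show "dist (\<phi> x) (\<phi> y) \<le> \<bar>K\<bar> * dist x y" .
  qed simp
  obtain g where g: "uniformly_continuous_on (closure W) g" "\<And>x. x \<in> W \<Longrightarrow> \<phi> x = g x"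
  proof (rule uniformly_continuous_on_extension_on_closure[OF lipschitz_on_uniformly_continuous[OF lip]])
    fix g assume "uniformly_continuous_on (closure W) g" "\<And>x. x \<in> W \<Longrightarrow> \<phi> x = g x"
    then show thesis by (rule that)
  qed
  have lim: "(\<lambda>n. \<phi> (a n)) \<longlonglongrightarrow> g x" if "\<And>n. a n \<in> W" "a \<longlonglongrightarrow> x" for a x
  proof -
    have "x \<in> closure W" using that closure_sequential by blast
    then have "(\<lambda>n. g (a n)) \<longlonglongrightarrow> g x"
    proof (rule continuous_on_tendsto_compose[OF uniformly_continuous_imp_continuous[OF g(1)] that(2)])
      show "\<forall>\<^sub>F n in sequentially. a n \<in> closure W"
        by (rule always_eventually) (use that(1) closure_subset in blast)
    qed
    then show ?thesis using g(2) that(1) by simp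
  qed
  show ?thesis
  proof
    show "restrict g (closure W) x = \<phi> x" if "x \<in> W" for x
      using that g(2) closure_subset by (auto simp: restrict_def)
    have cW: "subspace (closure W)" using W by (rule subspace_closure)
    have "g (x + y) = g x + g y" if xy: "x \<in> closure W" "y \<in> closure W" for x y
    proof -
      obtain a b where ab: "\<And>n. a n \<in> W" "a \<longlonglongrightarrow> x" "\<And>n. b n \<in> W" "b \<longlonglongrightarrow> y"
        using xy closure_sequential by metis
      have "(\<lambda>n. \<phi> (a n + b n)) \<longlonglongrightarrow> g (x + y)"
        using ab W by (intro lim subspace_add tendsto_add)
      moreover have "(\<lambda>n. \<phi> (a n + b n)) \<longlonglongrightarrow> g x + g y"
        using ab lim by (simp add: linear_on_subspace_add[OF lin] tendsto_add)
      ultimately show ?thesis by (rule LIMSEQ_unique)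
    qed
    moreover have "g (c *\<^sub>R x) = c *\<^sub>R g x" if x: "x \<in> closure W" for c x
    proof -
      obtain a where a: "\<And>n. a n \<in> W" "a \<longlonglongrightarrow> x"
        using x closure_sequential by metis
      have "(\<lambda>n. \<phi> (c *\<^sub>R a n)) \<longlonglongrightarrow> g (c *\<^sub>R x)"
        using a W by (intro lim subspace_scale tendsto_scaleR tendsto_const)
      moreover have "(\<lambda>n. \<phi> (c *\<^sub>R a n)) \<longlonglongrightarrow> c *\<^sub>R g x"
        using a lim by (simp add: linear_on_subspace_scale[OF lin] tendsto_mult_left)
      ultimately show ?thesis by (rule LIMSEQ_unique)
    qed
    moreover have "\<bar>g x\<bar> \<le> K * norm x" if x: "x \<in> closure W" for x
    proof -
      obtain a where a: "\<And>n. a n \<in> W" "a \<longlonglongrightarrow> x"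
        using x closure_sequential by metis
      show ?thesis
      proof (rule tendsto_le[OF sequentially_bot])
        show "(\<lambda>n. \<bar>\<phi> (a n)\<bar>) \<longlonglongrightarrow> \<bar>g x\<bar>" using lim[OF a] by (rule tendsto_rabs)
        show "(\<lambda>n. K * norm (a n)) \<longlonglongrightarrow> K * norm x" using a by (intro tendsto_intros)
      qed (use bd a in auto)
    qed
    ultimately show "restrict g (closure W) \<in> dual_of (closure W)"
      using cW by (auto simp: dual_of_def linear_on_subspace_def subspace_add subspace_scale intro!: exI[of _ K])
  qed
qed

text \<open>Bounded functionals are continuous, hence determined on the dense set \<open>W\<close>;
  outside the closure, extensionality decides.\<close>

lemma dual_of_closure_eqI:
  assumes "\<phi> \<in> dual_of (closure W)" "\<psi> \<in> dual_of (closure W)" "\<And>x. x \<in> W \<Longrightarrow> \<phi> x = \<psi> x"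
  shows "\<phi> = \<psi>"
proof (rule extensionalityI[of _ "closure W"])
  show "\<phi> \<in> extensional (closure W)" "\<psi> \<in> extensional (closure W)" using assms by (auto simp: dual_of_def)
  fix x assume x: "x \<in> closure W"
  have lim: "(\<lambda>n. \<xi> (a n)) \<longlonglongrightarrow> \<xi> x" if \<xi>: "\<xi> \<in> dual_of (closure W)" and a: "\<And>n. a n \<in> W" "a \<longlonglongrightarrow> x" for \<xi> a
  proof -
    obtain K where lin: "linear_on_subspace (closure W) \<xi>" and K: "\<And>x. x \<in> closure W \<Longrightarrow> \<bar>\<xi> x\<bar> \<le> K * norm x"
      using \<xi> by (auto simp: dual_of_def)
    have aW: "a n \<in> closure W" for n using a(1) closure_subset by blast
    have "(\<lambda>n. \<xi> (a n) - \<xi> x) \<longlonglongrightarrow> 0"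
    proof (rule Lim_null_comparison)
      have "norm (\<xi> (a n) - \<xi> x) \<le> K * norm (a n - x)" for n
        using K[of "a n - x"] linear_on_subspace_diff[OF lin aW x] subspace_diff[OF linear_on_subspace_subspace[OF lin] aW x] by simp
      then show "\<forall>\<^sub>F n in sequentially. norm (\<xi> (a n) - \<xi> x) \<le> K * norm (a n - x)" by simp
      show "(\<lambda>n. K * norm (a n - x)) \<longlonglongrightarrow> 0"
        using tendsto_norm_zero[OF LIM_zero[OF a(2)]] by (rule tendsto_mult_right_zero)
    qed
    then show ?thesis by (rule LIM_zero_cancel)
  qed
  obtain a where a: "\<And>n. a n \<in> W" "a \<longlonglongrightarrow> x" using x closure_sequential by metis
  show "\<phi> x = \<psi> x"
    using lim[OF assms(1) a] lim[OF assms(2) a] assms(3) a(1) by (simp add: LIMSEQ_unique)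
qed

text \<open>Justifies the definite description in \<open>adj\<close>: extending the bounded
  functional \<open>\<lambda>e. inner \<sigma> (E e)\<close> gives existence, and density gives
  uniqueness.\<close>

lemma adj_properties:
  fixes E :: "'x::real_normed_vector \<Rightarrow> 'h::real_inner"
  assumes lin: "linear_on_subspace W E" and \<sigma>: "\<sigma> \<in> adj_dom W E"
  shows "adj W E \<sigma> \<in> dual_of (closure W)" "\<And>e. e \<in> W \<Longrightarrow> adj W E \<sigma> e = inner \<sigma> (E e)"
proof -
  obtain K where K: "\<And>e. e \<in> W \<Longrightarrow> \<bar>inner \<sigma> (E e)\<bar> \<le> K * norm e" using \<sigma>
    by (auto simp: adj_dom_def)
  have "linear_on_subspace W (\<lambda>e. inner \<sigma> (E e))"
    using lin by (auto simp: linear_on_subspace_def inner_add_right)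
  then obtain \<psi> where \<psi>: "\<psi> \<in> dual_of (closure W)" "\<And>x. x \<in> W \<Longrightarrow> \<psi> x = inner \<sigma> (E x)"
    using subspace_functional_extension[OF _ K] by metis
  have "adj W E \<sigma> \<in> dual_of (closure W) \<and> (\<forall>e\<in>W. adj W E \<sigma> e = inner \<sigma> (E e))"
    unfolding adj_def
  proof (rule theI[where P="\<lambda>\<phi>. \<phi> \<in> dual_of (closure W) \<and> (\<forall>e\<in>W. \<phi> e = inner \<sigma> (E e))" and a=\<psi>])
    show "\<psi> \<in> dual_of (closure W) \<and> (\<forall>e\<in>W. \<psi> e = inner \<sigma> (E e))" using \<psi> by blast
    show "\<xi> = \<psi>" if "\<xi> \<in> dual_of (closure W) \<and> (\<forall>e\<in>W. \<xi> e = inner \<sigma> (E e))" for \<xi>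
      using that \<psi> by (intro dual_of_closure_eqI[of \<xi> W \<psi>]) auto
  qed
  then show "adj W E \<sigma> \<in> dual_of (closure W)" "\<And>e. e \<in> W \<Longrightarrow> adj W E \<sigma> e = inner \<sigma> (E e)" by auto
qed

text \<open>Reduces equilibrium to testing on \<open>W\<close>. Membership in the domain of the
  adjoint is automatic, since \<open>\<phi>\<close> provides the required bound.\<close>

lemma adj_eq_iff:
  fixes E :: "'x::real_normed_vector \<Rightarrow> 'h::real_inner"
  assumes lin: "linear_on_subspace W E" and \<phi>: "\<phi> \<in> dual_of (closure W)"
  shows "\<sigma> \<in> adj_dom W E \<and> adj W E \<sigma> = \<phi> \<longleftrightarrow> (\<forall>e\<in>W. inner \<sigma> (E e) = \<phi> e)"
proof
  assume "\<sigma> \<in> adj_dom W E \<and> adj W E \<sigma> = \<phi>"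
  then show "\<forall>e\<in>W. inner \<sigma> (E e) = \<phi> e" using adj_properties[OF lin] by auto
next
  assume *: "\<forall>e\<in>W. inner \<sigma> (E e) = \<phi> e"
  obtain K where "\<And>x. x \<in> closure W \<Longrightarrow> \<bar>\<phi> x\<bar> \<le> K * norm x" using \<phi> by (auto simp: dual_of_def)
  then have dom: "\<sigma> \<in> adj_dom W E" using * closure_subset[of W] by (auto simp: adj_dom_def)
  moreover have "adj W E \<sigma> = \<phi>"
    using adj_properties[OF lin dom] \<phi> * by (intro dual_of_closure_eqI[of _ W]) auto
  ultimately show "\<sigma> \<in> adj_dom W E \<and> adj W E \<sigma> = \<phi>" by blast
qed

lemma adj_ker_iff:
  fixes E :: "'x::real_normed_vector \<Rightarrow> 'h::real_inner"
  assumes lin: "linear_on_subspace W E"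
  shows "\<sigma> \<in> adj_ker W E \<longleftrightarrow> (\<forall>e\<in>W. inner \<sigma> (E e) = 0)"
proof -
  have S: "subspace (closure W)" using linear_on_subspace_subspace[OF lin] by (rule subspace_closure)
  have "(\<lambda>x\<in>closure W. 0) \<in> dual_of (closure W)"
    using S by (auto simp: dual_of_def linear_on_subspace_def subspace_add subspace_scale intro!: exI[of _ 0])
  from adj_eq_iff[OF lin this] show ?thesis
    using closure_subset[of W] by (auto simp: adj_ker_def)
qed

section \<open>The weighted orthogonal decomposition\<close>

lemma linear_on_subspace_minus:
  fixes \<phi> \<psi> :: "'x::real_vector \<Rightarrow> real"
  assumes "linear_on_subspace S \<phi>" "linear_on_subspace S \<psi>"
  shows "linear_on_subspace S (\<lambda>x. \<phi> x - \<psi> x)"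
  using assms by (auto simp: linear_on_subspace_def algebra_simps)

text \<open>The bound by \<open>K\<close> makes the supremum in \<open>dual_norm\<close> one of a
  set bounded above, so that it dominates its members; rescaling to the unit ball gives the
  estimate.\<close>

lemma dual_norm_bound:
  assumes lin: "linear_on_subspace S \<phi>" and K: "\<And>x. x \<in> S \<Longrightarrow> \<bar>\<phi> x\<bar> \<le> K * norm x"
  shows "0 \<le> dual_norm S \<phi>" "\<And>x. x \<in> S \<Longrightarrow> \<bar>\<phi> x\<bar> \<le> dual_norm S \<phi> * norm x"
proof -
  note S = linear_on_subspace_subspace[OF lin]
  have bdd: "bdd_above ((\<lambda>x. \<bar>\<phi> x\<bar>) ` {x \<in> S. norm x \<le> 1})"
  proof (rule bdd_aboveI2)
    fix x assume x: "x \<in> {x \<in> S. norm x \<le> 1}"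
    then have "\<bar>\<phi> x\<bar> \<le> K * norm x" using K by blast
    also have "\<dots> \<le> \<bar>K\<bar> * norm x" by (intro mult_right_mono) auto
    also have "\<dots> \<le> \<bar>K\<bar>" using x by (simp add: mult_left_le)
    finally show "\<bar>\<phi> x\<bar> \<le> \<bar>K\<bar>" .
  qed
  have le: "\<bar>\<phi> x\<bar> \<le> dual_norm S \<phi>" if "x \<in> S" "norm x \<le> 1" for x
    unfolding dual_norm_def by (rule cSUP_upper[OF _ bdd]) (use that in auto)
  have "0 \<le> \<bar>\<phi> 0\<bar>" by simp
  also have "\<dots> \<le> dual_norm S \<phi>" by (rule le) (use subspace_0[OF S] in auto)
  finally show "0 \<le> dual_norm S \<phi>" .
  fix x assume x: "x \<in> S"
  show "\<bar>\<phi> x\<bar> \<le> dual_norm S \<phi> * norm x"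
  proof (cases "x = 0")
    case True then show ?thesis using linear_on_subspace_0[OF lin] by simp
  next
    case False
    have "\<bar>\<phi> (inverse (norm x) *\<^sub>R x)\<bar> \<le> dual_norm S \<phi>"
      using x False subspace_scale[OF S] by (intro le) auto
    then have "inverse (norm x) * \<bar>\<phi> x\<bar> \<le> dual_norm S \<phi>"
      unfolding linear_on_subspace_scale[OF lin x] by (simp add: abs_mult)
    then show ?thesis using False by (simp add: field_simps)
  qed
qed

text \<open>The scalar function \<open>\<lambda>s. inner (u s) p\<close> vanishes on the interval,
  and its derivative there is unique. It carries a constraint valid at all times over to the
  rates.\<close>

lemma has_vector_derivative_orthogonal:
  fixes u :: "real \<Rightarrow> 'h::real_inner"
  assumes "T > 0" "t \<in> {0..T}" "(u has_vector_derivative D) (at t within {0..T})"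
    and "\<And>s. s \<in> {0..T} \<Longrightarrow> inner (u s) p = 0"
  shows "inner D p = 0"
proof -
  have "((\<lambda>s. inner (u s) p) has_vector_derivative inner D p) (at t within {0..T})"
    using bounded_linear.has_vector_derivative[OF bounded_linear_inner_left assms(3)] .
  then have "((\<lambda>s. 0) has_vector_derivative inner D p) (at t within {0..T})"
    by (rule has_vector_derivative_transform[OF assms(2), rotated]) (use assms(4) in simp)
  then show ?thesis
    using vector_derivative_within_cbox[of 0 T t] assms(1,2) has_vector_derivative_const
    by (metis box_real(2))
qed

section \<open>The operator \<open>C\<close> and the complementary spaces \<open>U\<close> and
  \<open>V\<close>\<close>

locale elasticity =
  fixes c0 :: real and W0 :: "'x::banach set"
    and E :: "'x \<Rightarrow> 'h::{real_inner,banach,second_countable_topology}" and C :: "'h \<Rightarrow> 'h"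
  assumes lin: "linear_on_subspace W0 E"
    and graph: "closed ((\<lambda>e. (e, E e)) ` W0)"
    and range: "closed (E ` W0)"
    and C_bounded: "bounded_linear C"
    and C_sym: "\<And>\<sigma> \<tau>. inner (C \<sigma>) \<tau> = inner \<sigma> (C \<tau>)"
    and c0: "c0 > 0"
    and C_coercive: "\<And>\<tau>. inner (C \<tau>) \<tau> \<ge> c0 * (norm \<tau>)\<^sup>2"
begin

sublocale C: bounded_linear C by (rule C_bounded)

abbreviation "A \<equiv> inv C"
abbreviation "U \<equiv> space_U W0 E C"
abbreviation "V \<equiv> adj_ker W0 E"

lemma norm_le_norm_C: "c0 * norm \<tau> \<le> norm (C \<tau>)"
proof (cases "\<tau> = 0")
  case False
  have "c0 * norm \<tau> * norm \<tau> \<le> inner (C \<tau>) \<tau>" using C_coercive[of \<tau>] by (simp add: power2_eq_square mult.assoc)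
  also have "\<dots> \<le> norm (C \<tau>) * norm \<tau>" by (rule norm_cauchy_schwarz)
  finally show ?thesis using False by simp
qed simp

text \<open>Coercivity bounds \<open>C\<close> from below, whence injectivity; surjectivity is the
  variational problem solved on the whole space.\<close>

lemma bij_C: "bij C"
proof (rule bijI)
  show "inj C"
  proof (rule injI)
    fix x y assume "C x = C y"
    then have "c0 * norm (x - y) \<le> 0" using norm_le_norm_C[of "x - y"] by (simp add: C.diff)
    then show "x = y" using c0 by (simp add: mult_le_0_iff)
  qed
  show "surj C"
    unfolding surj_def
  proof
    fix y
    obtain h where h: "\<And>r. inner (C h) r = inner y r"
      using symmetric_coercive_solution[OF C_bounded C_sym c0 C_coercive subspace_UNIV closed_UNIV, of y] by blast
    then have "C h = y" by (metis inner_diff_left inner_eq_zero_iff right_minus_eq)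
    then show "\<exists>x. y = C x" by blast
  qed
qed

lemma C_A [simp]: "C (A x) = x" using bij_C by (simp add: bij_is_surj surj_f_inv_f)
lemma A_C [simp]: "A (C x) = x" using bij_C by (simp add: bij_is_inj)

lemma norm_A_le: "norm (A x) \<le> norm x * (1 / c0)"
  using norm_le_norm_C[of "A x"] c0 by (simp add: field_simps)

lemma A_bounded: "bounded_linear A"
proof (rule bounded_linear_intro)
  show "A (x + y) = A x + A y" for x y by (metis A_C C_A C.add)
  show "A (r *\<^sub>R x) = r *\<^sub>R A x" for r x by (metis A_C C_A C.scaleR)
qed (rule norm_A_le)

sublocale A: bounded_linear A by (rule A_bounded)

lemma inner_A_pos: "inner x (A x) \<ge> c0 * (norm (A x))\<^sup>2" using C_coercive[of "A x"] by simp

lemma V_iff: "\<sigma> \<in> V \<longleftrightarrow> (\<forall>e\<in>W0. inner \<sigma> (E e) = 0)" by (rule adj_ker_iff[OF lin])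

lemma V_diff: "x \<in> V \<Longrightarrow> y \<in> V \<Longrightarrow> x - y \<in> V" by (simp add: V_iff inner_diff_left)

lemma U_subspace: "subspace U"
  unfolding subspace_def space_U_def
proof (intro conjI ballI allI)
  show "0 \<in> (\<lambda>e. C (E e)) ` W0" using subspace_0[OF linear_on_subspace_subspace[OF lin]] linear_on_subspace_0[OF lin]
    by (intro image_eqI[of _ _ 0]) auto
  fix x assume "x \<in> (\<lambda>e. C (E e)) ` W0"
  then obtain a where a: "a \<in> W0" "x = C (E a)" by blast
  then show "c *\<^sub>R x \<in> (\<lambda>e. C (E e)) ` W0" for c
    using subspace_scale[OF linear_on_subspace_subspace[OF lin]] linear_on_subspace_scale[OF lin]
    by (intro image_eqI[of _ _ "c *\<^sub>R a"]) (auto simp: C.scaleR)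
  fix y assume "y \<in> (\<lambda>e. C (E e)) ` W0"
  then obtain b where b: "b \<in> W0" "y = C (E b)" by blast
  then show "x + y \<in> (\<lambda>e. C (E e)) ` W0"
    using a subspace_add[OF linear_on_subspace_subspace[OF lin]] linear_on_subspace_add[OF lin]
    by (intro image_eqI[of _ _ "a + b"]) (auto simp: C.add)
qed

text \<open>For \<open>u = C (E e)\<close>, symmetry moves \<open>C\<close> onto \<open>A v\<close>
  and leaves \<open>inner (E e) v\<close>, which vanishes on the kernel of the adjoint.\<close>

lemma U_V_orthogonal: "u \<in> U \<Longrightarrow> v \<in> V \<Longrightarrow> inner u (A v) = 0"
  by (auto simp: space_U_def V_iff C_sym inner_commute)

text \<open>The variational problem is solved on the closed range of \<open>E\<close>: its solution
  \<open>h\<close> gives the part \<open>C h\<close> in \<open>U\<close>, and its equation says that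
  the remainder annihilates the range, hence lies in \<open>V\<close>.\<close>

lemma decomposition: obtains u where "u \<in> U" "x - u \<in> V"
proof -
  obtain h where h: "h \<in> E ` W0" "\<And>r. r \<in> E ` W0 \<Longrightarrow> inner (C h) r = inner x r"
    using symmetric_coercive_solution[OF C_bounded C_sym c0 C_coercive linear_on_subspace_image[OF lin] range, of x] by blast
  show ?thesis
    by (rule that[of "C h"]) (use h in \<open>auto simp: space_U_def V_iff inner_diff_left\<close>)
qed

lemma U_Int_V: "u \<in> U \<Longrightarrow> u \<in> V \<Longrightarrow> u = 0"
proof -
  assume "u \<in> U" "u \<in> V"
  then have "c0 * (norm (A u))\<^sup>2 \<le> 0" using U_V_orthogonal inner_A_pos by metis
  then have "A u = 0" using c0 by (simp add: mult_le_0_iff)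
  then show "u = 0" by (metis C_A C.zero)
qed

text \<open>If \<open>u\<close> is orthogonal to \<open>V\<close>, its component in \<open>V\<close>
  is orthogonal to itself and vanishes. Membership in \<open>U\<close> thus becomes a family of
  scalar equations, which pass to derivatives and integrals.\<close>

lemma U_iff: "u \<in> U \<longleftrightarrow> (\<forall>v\<in>V. inner u (A v) = 0)"
proof
  assume *: "\<forall>v\<in>V. inner u (A v) = 0"
  obtain w where w: "w \<in> U" "u - w \<in> V" by (rule decomposition)
  have "inner (u - w) (A (u - w)) = 0"
    using * w U_V_orthogonal by (simp add: inner_diff_left)
  then have "c0 * (norm (A (u - w)))\<^sup>2 \<le> 0" using inner_A_pos by metis
  then have "A (u - w) = 0" using c0 by (simp add: mult_le_0_iff)
  then have "u - w = 0" by (metis C_A C.zero)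
  then show "u \<in> U" using w by simp
qed (use U_V_orthogonal in blast)

section \<open>The solution operators \<open>op_G\<close> and \<open>op_Q\<close>\<close>

lemma proj_inv_eqI:
  assumes "p \<in> V" "x - p \<in> U"
  shows "proj_inv C V x = p"
  unfolding proj_inv_def
proof (rule the_equality)
  show "p \<in> V \<and> (\<forall>v\<in>V. inner_inv C (x - p) v = 0)" using assms by (simp add: inner_inv_def U_iff)
  fix p' assume "p' \<in> V \<and> (\<forall>v\<in>V. inner_inv C (x - p') v = 0)"
  then have p': "p' \<in> V" "x - p' \<in> U" by (auto simp: inner_inv_def U_iff)
  have "p' - p = (x - p) - (x - p')" by simp
  then have "p' - p \<in> U" using assms p' U_subspace subspace_diff by metis
  moreover have "p' - p \<in> V" using assms p' by (intro V_diff)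
  ultimately show "p' = p" using U_Int_V by fastforce
qed

lemma op_G: "op_G W0 E C \<tau> \<in> V" "C \<tau> - op_G W0 E C \<tau> \<in> U"
proof -
  obtain u where "u \<in> U" "C \<tau> - u \<in> V" by (rule decomposition)
  moreover from this have "op_G W0 E C \<tau> = C \<tau> - u" unfolding op_G_def by (intro proj_inv_eqI) auto
  ultimately show "op_G W0 E C \<tau> \<in> V" "C \<tau> - op_G W0 E C \<tau> \<in> U" by auto
qed

lemma op_G_eqI: "p \<in> V \<Longrightarrow> C \<tau> - p \<in> U \<Longrightarrow> op_G W0 E C \<tau> = p"
  unfolding op_G_def by (rule proj_inv_eqI)

text \<open>Linearity follows from uniqueness of the decomposition. The norm estimate is made for
  \<open>A (?G x)\<close>, where coercivity acts, and then carried over by \<open>C\<close>.\<close>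

lemma op_G_bounded: "bounded_linear (op_G W0 E C)"
proof -
  obtain B where B: "0 \<le> B" "\<And>x. norm (C x) \<le> norm x * B" using C.nonneg_bounded by blast
  let ?G = "op_G W0 E C"
  show ?thesis
  proof (rule bounded_linear_intro)
    show "?G (x + y) = ?G x + ?G y" for x y
    proof (rule op_G_eqI)
      show "?G x + ?G y \<in> V" using op_G(1) by (simp add: V_iff inner_add_left)
      show "C (x + y) - (?G x + ?G y) \<in> U"
        using subspace_add[OF U_subspace op_G(2)[of x] op_G(2)[of y]] by (simp add: C.add algebra_simps)
    qed
    show "?G (r *\<^sub>R x) = r *\<^sub>R ?G x" for r x
    proof (rule op_G_eqI)
      show "r *\<^sub>R ?G x \<in> V" using op_G(1) by (simp add: V_iff)
      show "C (r *\<^sub>R x) - r *\<^sub>R ?G x \<in> U"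
        using subspace_scale[OF U_subspace op_G(2)[of x], of r] by (simp add: C.scaleR algebra_simps)
    qed
    fix x
    \<comment> \<open>The residual is tested with the projection itself.\<close>
    have "inner (C x - ?G x) (A (?G x)) = 0" using op_G U_V_orthogonal by blast
    then have "c0 * (norm (A (?G x)))\<^sup>2 \<le> inner (C x) (A (?G x))"
      using inner_A_pos[of "?G x"] by (simp add: inner_diff_left)
    also have "\<dots> \<le> norm (C x) * norm (A (?G x))" by (rule norm_cauchy_schwarz)
    finally have "c0 * norm (A (?G x)) * norm (A (?G x)) \<le> norm (C x) * norm (A (?G x))"
      by (simp add: power2_eq_square mult.assoc)
    then have "c0 * norm (A (?G x)) \<le> norm (C x)"
      by (cases "A (?G x) = 0") auto
    also have "\<dots> \<le> norm x * B" by (rule B(2))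
    finally have "norm (A (?G x)) \<le> norm x * B / c0" using c0 by (simp add: field_simps)
    then have "norm (A (?G x)) * B \<le> norm x * B / c0 * B" using B(1) by (rule mult_right_mono)
    then show "norm (?G x) \<le> norm x * (B * B / c0)" using B(2)[of "A (?G x)"] by simp
  qed
qed

text \<open>Two elements of \<open>U\<close> with the same adjoint differ by an element of
  \<open>V\<close>, hence by 0.\<close>

lemma op_Q_eqI:
  assumes "\<phi> \<in> dual_of (closure W0)" "\<sigma> \<in> U" "\<And>e. e \<in> W0 \<Longrightarrow> inner \<sigma> (E e) = \<phi> e"
  shows "op_Q W0 E C \<phi> = \<sigma>"
  unfolding op_Q_def
proof (rule the_equality)
  show "\<sigma> \<in> U \<inter> adj_dom W0 E \<and> adj W0 E \<sigma> = \<phi>" using adj_eq_iff[OF lin assms(1), of \<sigma>] assms by blast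
  fix \<sigma>' assume "\<sigma>' \<in> U \<inter> adj_dom W0 E \<and> adj W0 E \<sigma>' = \<phi>"
  then have s': "\<sigma>' \<in> U" "\<forall>e\<in>W0. inner \<sigma>' (E e) = \<phi> e" using adj_eq_iff[OF lin assms(1), of \<sigma>'] by auto
  then have "\<sigma>' - \<sigma> \<in> V" using assms(3) by (simp add: V_iff inner_diff_left)
  moreover have "\<sigma>' - \<sigma> \<in> U" using s' assms U_subspace by (intro subspace_diff)
  ultimately show "\<sigma>' = \<sigma>" using U_Int_V by fastforce
qed

lemma adj_image_dual: "\<phi> \<in> adj_image W0 E \<Longrightarrow> \<phi> \<in> dual_of (closure W0)"
  using adj_properties(1)[OF lin] by (auto simp: adj_image_def)

text \<open>The component in \<open>U\<close> of any preimage under the adjoint is again a preimage,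
  because the component in \<open>V\<close> is annihilated.\<close>

lemma op_Q:
  assumes "\<phi> \<in> adj_image W0 E"
  shows "op_Q W0 E C \<phi> \<in> U" "\<And>e. e \<in> W0 \<Longrightarrow> inner (op_Q W0 E C \<phi>) (E e) = \<phi> e"
proof -
  obtain \<sigma> where \<sigma>: "\<sigma> \<in> adj_dom W0 E" "\<phi> = adj W0 E \<sigma>" using assms by (auto simp: adj_image_def)
  obtain u where u: "u \<in> U" "\<sigma> - u \<in> V" by (rule decomposition)
  have ue: "inner u (E e) = \<phi> e" if "e \<in> W0" for e
    using u(2) that adj_properties(2)[OF lin \<sigma>(1) that] by (simp add: V_iff \<sigma>(2) inner_diff_left)
  have "op_Q W0 E C \<phi> = u" using adj_image_dual[OF assms] u(1) ue by (rule op_Q_eqI)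
  then show "op_Q W0 E C \<phi> \<in> U" "\<And>e. e \<in> W0 \<Longrightarrow> inner (op_Q W0 E C \<phi>) (E e) = \<phi> e" using u ue by auto
qed

text \<open>The quantitative form of the boundedness of \<open>op_Q\<close>. For
  \<open>\<sigma> = C h\<close> one tests with a preimage \<open>e\<close> of \<open>h\<close> whose
  norm is controlled by that of \<open>h\<close>, and coercivity bounds \<open>h\<close>. The
  constant combines the preimage bound, \<open>1 / c0\<close> and a bound of
  \<open>C\<close>.\<close>

lemma U_norm_bound:
  obtains K where "0 \<le> K"
    "\<And>\<sigma> N. \<sigma> \<in> U \<Longrightarrow> 0 \<le> N \<Longrightarrow> (\<And>e. e \<in> W0 \<Longrightarrow> \<bar>inner \<sigma> (E e)\<bar> \<le> N * norm e) \<Longrightarrow> norm \<sigma> \<le> K * N"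
proof -
  obtain K where K: "0 \<le> K" "\<And>h. h \<in> E ` W0 \<Longrightarrow> \<exists>e\<in>W0. E e = h \<and> norm e \<le> K * norm h"
    using closed_operator_bounded_preimage[OF lin graph range] by blast
  obtain B where B: "0 \<le> B" "\<And>x. norm (C x) \<le> norm x * B" using C.nonneg_bounded by blast
  show ?thesis
  proof
    show "0 \<le> K / c0 * B" using K B c0 by simp
    fix \<sigma> N assume \<sigma>: "\<sigma> \<in> U" and N: "0 \<le> N" "\<And>e. e \<in> W0 \<Longrightarrow> \<bar>inner \<sigma> (E e)\<bar> \<le> N * norm e"
    then obtain h where h: "h \<in> E ` W0" "\<sigma> = C h" by (auto simp: space_U_def)
    obtain e where e: "e \<in> W0" "E e = h" "norm e \<le> K * norm h" using K(2) h(1) by blast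
    have "c0 * norm h * norm h \<le> inner \<sigma> (E e)"
      using C_coercive[of h] h e by (simp add: power2_eq_square mult.assoc)
    also have "\<dots> \<le> N * norm e" using N(2)[OF e(1)] by simp
    also have "\<dots> \<le> N * (K * norm h)" using e(3) N(1) by (rule mult_left_mono)
    finally have "c0 * norm h * norm h \<le> N * K * norm h" by (simp only: mult.assoc)
    then have "c0 * norm h \<le> N * K" using N(1) K(1) by (cases "h = 0") auto
    then have "norm h \<le> N * K / c0" using c0 by (simp add: field_simps)
    then have "norm h * B \<le> N * K / c0 * B" using B(1) by (rule mult_right_mono)
    then show "norm \<sigma> \<le> K / c0 * B * N" using B(2)[of h] h(2) by (simp add: mult_ac)
  qed
qed

text \<open>The candidate density is \<open>?Q (v t)\<close>. It is measurable as an a.e. limit of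
  the simple functions \<open>?Q (s n t)\<close>, and its primitive is identified by testing against
  the range of \<open>E\<close>.\<close>

lemma W1_inf_op_Q:
  assumes f: "W1_inf_dual T (closure W0) (adj_image W0 E) f"
  shows "W1_inf T norm (\<lambda>t. op_Q W0 E C (f t))"
proof -
  let ?S = "closure W0" and ?R = "adj_image W0 E" and ?Q = "op_Q W0 E C"
  obtain v s K where fR: "\<And>t. t \<in> {0..T} \<Longrightarrow> f t \<in> ?R"
    and vR: "\<And>t. t \<in> {0..T} \<Longrightarrow> v t \<in> ?R"
    and s: "\<And>n. simple_function (lebesgue_on {0..T}) (s n)" "\<And>n t. t \<in> {0..T} \<Longrightarrow> s n t \<in> ?R"
      "AE t in lebesgue_on {0..T}. (\<lambda>n::nat. dual_norm ?S (\<lambda>x. s n t x - v t x)) \<longlonglongrightarrow> 0"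
    and K: "AE t in lebesgue_on {0..T}. dual_norm ?S (v t) \<le> K"
    and int: "\<And>t x. t \<in> {0..T} \<Longrightarrow> x \<in> ?S \<Longrightarrow> f t x = f 0 x + (LINT s:{0..t}|lebesgue. v s x)"
    using f unfolding W1_inf_dual_def by blast
  obtain B where B: "0 \<le> B" "\<And>\<sigma> N. \<sigma> \<in> U \<Longrightarrow> 0 \<le> N \<Longrightarrow>
      (\<And>e. e \<in> W0 \<Longrightarrow> \<bar>inner \<sigma> (E e)\<bar> \<le> N * norm e) \<Longrightarrow> norm \<sigma> \<le> B * N"
    using U_norm_bound by blast
  \<comment> \<open>The Lipschitz estimate is direct: the difference lies in \<open>U\<close>, and
    pairing it with \<open>E e\<close> gives \<open>\<phi> e - \<psi> e\<close>.\<close>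
  have Qdiff: "norm (?Q \<phi> - ?Q \<psi>) \<le> B * dual_norm ?S (\<lambda>x. \<phi> x - \<psi> x)" if R: "\<phi> \<in> ?R" "\<psi> \<in> ?R" for \<phi> \<psi>
  proof -
    obtain K1 K2 where l: "linear_on_subspace ?S \<phi>" "\<And>x. x \<in> ?S \<Longrightarrow> \<bar>\<phi> x\<bar> \<le> K1 * norm x"
      "linear_on_subspace ?S \<psi>" "\<And>x. x \<in> ?S \<Longrightarrow> \<bar>\<psi> x\<bar> \<le> K2 * norm x"
      using adj_image_dual[OF R(1)] adj_image_dual[OF R(2)] unfolding dual_of_def by blast
    have "\<bar>\<phi> x - \<psi> x\<bar> \<le> (K1 + K2) * norm x" if "x \<in> ?S" for x
      using l(2)[OF that] l(4)[OF that] abs_triangle_ineq4[of "\<phi> x" "\<psi> x"] by (simp add: distrib_right)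
    note d = dual_norm_bound[OF linear_on_subspace_minus[OF l(1,3)] this]
    show ?thesis
    proof (rule B(2))
      show "?Q \<phi> - ?Q \<psi> \<in> U" using op_Q(1) R U_subspace by (intro subspace_diff)
      show "0 \<le> dual_norm ?S (\<lambda>x. \<phi> x - \<psi> x)" by (rule d(1))
      fix e assume e: "e \<in> W0"
      then show "\<bar>inner (?Q \<phi> - ?Q \<psi>) (E e)\<bar> \<le> dual_norm ?S (\<lambda>x. \<phi> x - \<psi> x) * norm e"
        using d(2)[of e] closure_subset[of W0] op_Q(2)[OF R(1) e] op_Q(2)[OF R(2) e] by (auto simp: inner_diff_left)
    qed
  qed
  have Qnorm: "norm (?Q \<phi>) \<le> B * dual_norm ?S \<phi>" if R: "\<phi> \<in> ?R" for \<phi>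
  proof -
    obtain K1 where l: "linear_on_subspace ?S \<phi>" "\<And>x. x \<in> ?S \<Longrightarrow> \<bar>\<phi> x\<bar> \<le> K1 * norm x"
      using adj_image_dual[OF R] unfolding dual_of_def by blast
    note d = dual_norm_bound[OF l]
    show ?thesis
    proof (rule B(2))
      fix e assume e: "e \<in> W0"
      then show "\<bar>inner (?Q \<phi>) (E e)\<bar> \<le> dual_norm ?S \<phi> * norm e"
        using d(2)[of e] closure_subset[of W0] op_Q(2)[OF R e] by auto
    qed (use d(1) op_Q(1)[OF R] in auto)
  qed
  \<comment> \<open>\<open>lim\<close> has some value at every time, so measurability holds
    throughout; convergence to \<open>?Q (v t)\<close> is known only almost everywhere.\<close>
  define l where "l t = lim (\<lambda>n. ?Q (s n t))" for t
  have "l \<in> borel_measurable (lebesgue_on {0..T})"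
    unfolding l_def
    by (intro borel_measurable_lim_metric borel_measurable_simple_function simple_function_compose1[OF s(1)])
  then have lm: "(\<lambda>t. indicator {0..T} t *\<^sub>R l t) \<in> borel_measurable lebesgue"
    by (subst (asm) borel_measurable_restrict_space_iff) auto
  define w where "w t = (if norm (indicator {0..T} t *\<^sub>R l t) \<le> B * K then indicator {0..T} t *\<^sub>R l t else 0)" for t
  have wm: "w \<in> borel_measurable lebesgue" unfolding w_def using lm by measurable
  have wb: "norm (w t) \<le> max (B * K) 0" for t by (auto simp: w_def)
  have "AE t in lebesgue_on {0..T}. w t = ?Q (v t)"
    using s(3) K AE_time
  proof eventually_elim
    case (elim t)
    have "(\<lambda>n. ?Q (s n t) - ?Q (v t)) \<longlonglongrightarrow> 0"
    proof (rule Lim_null_comparison)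
      show "\<forall>\<^sub>F n in sequentially. norm (?Q (s n t) - ?Q (v t)) \<le> B * dual_norm ?S (\<lambda>x. s n t x - v t x)"
        using Qdiff s(2) vR elim(3) by simp
      show "(\<lambda>n. B * dual_norm ?S (\<lambda>x. s n t x - v t x)) \<longlonglongrightarrow> 0"
        using elim(1) by (rule tendsto_mult_right_zero)
    qed
    then have "(\<lambda>n. ?Q (s n t)) \<longlonglongrightarrow> ?Q (v t)" by (rule LIM_zero_cancel)
    then have "l t = ?Q (v t)" unfolding l_def by (rule limI)
    moreover have "norm (?Q (v t)) \<le> B * K"
      using Qnorm[OF vR[OF elim(3)]] mult_left_mono[OF elim(2) B(1)] by linarith
    ultimately show ?case using elim(3) by (simp add: w_def)
  qed
  then have ae: "AE t in lebesgue. t \<in> {0..T} \<longrightarrow> w t = ?Q (v t)"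
    by (subst (asm) AE_restrict_space_iff) auto
  show ?thesis
  proof (rule W1_infI[where nrm=norm, OF wm wb])
    fix t assume t: "t \<in> {0..T}"
    then have T0: "0 \<in> {0..T}" by auto
    let ?I = "LINT s:{0..t}|lebesgue. w s"
    have wi: "integrable lebesgue (\<lambda>s. indicator {0..t} s *\<^sub>R w s)"
      using set_integrable_bounded[OF wm wb, of 0 t] by (simp add: set_integrable_def)
    then have inn: "inner ?I p = (LINT s|lebesgue. inner (indicator {0..t} s *\<^sub>R w s) p)" for p
      by (subst integral_inner_left) (auto simp: set_lebesgue_integral_def)
    \<comment> \<open>By the characterisation of \<open>op_Q\<close>, it suffices that the
      right-hand side lies in \<open>U\<close> and pairs with each \<open>E e\<close> to
      \<open>f t e\<close>.\<close>
    show "?Q (f t) = ?Q (f 0) + ?I"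
    proof (rule op_Q_eqI[OF adj_image_dual[OF fR[OF t]]])
      have "inner ?I (A p) = 0" if p: "p \<in> V" for p
        unfolding inn
      proof (rule integral_eq_zero_AE)
        show "AE s in lebesgue. inner (indicator {0..t} s *\<^sub>R w s) (A p) = 0"
          using ae by eventually_elim
            (use t p vR op_Q(1) U_V_orthogonal in \<open>auto simp: indicator_def\<close>)
      qed
      then have "?I \<in> U" by (simp add: U_iff)
      then show "?Q (f 0) + ?I \<in> U" using op_Q(1)[OF fR[OF T0]] U_subspace by (intro subspace_add)
      fix e assume e: "e \<in> W0"
      let ?a = "\<lambda>s. inner (indicator {0..t} s *\<^sub>R w s) (E e)" and ?b = "\<lambda>s. indicator {0..t} s *\<^sub>R v s e"
      have eq: "AE s in lebesgue. ?a s = ?b s"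
        using ae by eventually_elim (use t e vR op_Q(2) in \<open>auto simp: indicator_def\<close>)
      have am: "?a \<in> borel_measurable lebesgue"
        using borel_measurable_integrable[OF wi] by (intro borel_measurable_inner) auto
      \<comment> \<open>Measurability of \<open>?b\<close> is inherited from \<open>?a\<close>
        through their equality almost everywhere, Lebesgue measure being complete.\<close>
      have "inner ?I (E e) = (LINT s|lebesgue. ?b s)"
        unfolding inn by (rule integral_cong_AE[OF am borel_measurable_AE[OF am eq] eq])
      then have "inner ?I (E e) = (LINT s:{0..t}|lebesgue. v s e)" by (simp add: set_lebesgue_integral_def)
      then show "inner (?Q (f 0) + ?I) (E e) = f t e"
        using op_Q(2)[OF fR[OF T0] e] int[OF t, of e] e closure_subset[of W0] by (auto simp: inner_add_left)
    qed
  qed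
qed

lemma elastic_stress_W1_inf:
  assumes "W1_inf T norm g" "W1_inf_dual T (closure W0) (adj_image W0 E) f"
  shows "W1_inf T norm (elastic_stress W0 E C g f)"
  using W1_inf_add[OF W1_inf_bounded_linear[OF assms(1) op_G_bounded] W1_inf_op_Q[OF assms(2)]]
  by (simp add: elastic_stress_def[abs_def])

section \<open>Equivalence of the weighted norm and the original one\<close>

lemma norm_inv_le: "norm_inv C x \<le> sqrt (1 / c0) * norm x"
proof -
  have "inner x (A x) \<le> norm x * norm (A x)" by (rule norm_cauchy_schwarz)
  also have "\<dots> \<le> norm x * (norm x * (1 / c0))" by (intro mult_left_mono norm_A_le) auto
  also have "\<dots> = (1 / c0) * (norm x)\<^sup>2" by (simp add: power2_eq_square)
  finally have "norm_inv C x \<le> sqrt ((1 / c0) * (norm x)\<^sup>2)" by (simp add: norm_inv_def inner_inv_def)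
  then show ?thesis by (simp only: real_sqrt_mult real_sqrt_abs abs_norm_cancel)
qed

lemma norm_le_norm_inv: obtains M where "0 \<le> M" "\<And>x. norm x \<le> M * norm_inv C x"
proof -
  obtain B where B: "0 \<le> B" "\<And>x. norm (C x) \<le> norm x * B" using C.nonneg_bounded by blast
  show ?thesis
  proof
    show "0 \<le> B / sqrt c0" using B c0 by simp
    fix x
    have "sqrt (c0 * (norm (A x))\<^sup>2) \<le> norm_inv C x" using inner_A_pos[of x] by (simp add: norm_inv_def inner_inv_def)
    then have "sqrt c0 * norm (A x) \<le> norm_inv C x" by (simp add: real_sqrt_mult)
    then have "norm (A x) \<le> norm_inv C x / sqrt c0" using c0 by (simp add: field_simps)
    then have "norm (A x) * B \<le> norm_inv C x / sqrt c0 * B" using B(1) by (rule mult_right_mono)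
    then show "norm x \<le> B / sqrt c0 * norm_inv C x" using B(2)[of "A x"] by (simp add: mult_ac)
  qed
qed

lemma W1_inf_norm_inv: "W1_inf T (norm_inv C) u \<longleftrightarrow> W1_inf T norm u"
proof
  obtain M where M: "0 \<le> M" "\<And>x. norm x \<le> M * norm_inv C x" by (rule norm_le_norm_inv) blast
  show "W1_inf T (norm_inv C) u \<Longrightarrow> W1_inf T norm u" by (rule W1_inf_norm_mono[OF _ M])
  show "W1_inf T norm u \<Longrightarrow> W1_inf T (norm_inv C) u"
    by (rule W1_inf_norm_mono[where M="sqrt (1 / c0)"]) (use c0 norm_inv_le in auto)
qed

section \<open>The two problems at one instant\<close>

lemma mem_translate: "x \<in> translate S a \<longleftrightarrow> x - a \<in> S"
  unfolding translate_def by (metis (no_types, lifting) diff_add_cancel add_diff_cancel image_iff)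

text \<open>Modulo \<open>U\<close>, the elastic stress equals \<open>C (g t)\<close>, so
  compatibility may be measured from either. It also has adjoint \<open>f t\<close>, so the
  admissible stresses are exactly its translates by \<open>V\<close>.\<close>

lemma EPP_static_iff:
  assumes "f t \<in> adj_image W0 E"
  shows "EPP_static W0 E C (g t) (f t) e eel ep s \<longleftrightarrow>
    C e - elastic_stress W0 E C g f t \<in> U \<and> e = eel + ep \<and> s = C eel \<and> s - elastic_stress W0 E C g f t \<in> V"
proof -
  let ?st = "elastic_stress W0 E C g f t"
  have gU: "C (g t) - ?st \<in> U"
    using subspace_diff[OF U_subspace op_G(2)[of "g t"] op_Q(1)[OF assms]] by (simp add: elastic_stress_def algebra_simps)
  have "C e - ?st \<in> U \<longleftrightarrow> C e - C (g t) \<in> U"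
  proof
    assume "C e - ?st \<in> U"
    from subspace_diff[OF U_subspace this gU] show "C e - C (g t) \<in> U" by simp
  next
    assume "C e - C (g t) \<in> U"
    from subspace_add[OF U_subspace this gU] show "C e - ?st \<in> U" by simp
  qed
  also have "\<dots> \<longleftrightarrow> e - g t \<in> E ` W0"
    unfolding space_U_def C.diff[symmetric] image_iff by (metis (no_types) A_C)
  finally have 1: "e \<in> translate (E ` W0) (g t) \<longleftrightarrow> C e - ?st \<in> U" by (simp add: mem_translate)
  have "inner ?st (E w) = f t w" if "w \<in> W0" for w
    using op_Q(2)[OF assms that] op_G(1)[of "g t"] that by (simp add: elastic_stress_def inner_add_left V_iff)
  then have 2: "s \<in> adj_dom W0 E \<and> adj W0 E s = f t \<longleftrightarrow> s - ?st \<in> V"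
    unfolding adj_eq_iff[OF lin adj_image_dual[OF assms]] by (simp add: V_iff inner_diff_left)
  show ?thesis unfolding EPP_static_def 1 2 by blast
qed

text \<open>\<open>C\<close> cancels the weight in the inner product, and the translation cancels in
  differences of points.\<close>

lemma normal_cone_weighted_iff:
  "C z \<in> normal_cone (inner_inv C) (translate \<Sigma> (- a)) (s - a) \<longleftrightarrow> z \<in> normal_cone inner \<Sigma> s"
proof -
  have "inner_inv C (C z) x = inner z x" for x by (simp add: inner_inv_def C_sym)
  then show ?thesis by (auto simp: normal_cone_def translate_def)
qed

text \<open>Here \<open>k\<close>, \<open>s'\<close> and \<open>e\<close> stand for the rates of
  elastic stress, stress and total strain. Undoing both translations leaves \<open>C e - s'\<close>,
  which is \<open>C\<close> applied to the plastic rate \<open>e - A s'\<close>.\<close>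

lemma strain_rate_iff:
  assumes "C e - k \<in> U"
  shows "e \<in> A ` translate (translate (normal_cone (inner_inv C) (translate \<Sigma> (- a)) (s - a)) (s' - k) \<inter> U) k
    \<longleftrightarrow> e - A s' \<in> normal_cone inner \<Sigma> s" (is "?l \<longleftrightarrow> ?r")
proof -
  have "?l \<longleftrightarrow> C e \<in> translate (translate (normal_cone (inner_inv C) (translate \<Sigma> (- a)) (s - a)) (s' - k) \<inter> U) k"
    by (metis (no_types, lifting) A_C C_A image_iff)
  also have "\<dots> \<longleftrightarrow> C (e - A s') \<in> normal_cone (inner_inv C) (translate \<Sigma> (- a)) (s - a)"
    using assms by (simp add: mem_translate C.diff algebra_simps)
  finally show ?thesis by (simp only: normal_cone_weighted_iff)
qed

text \<open>Write \<open>- (s' - k)\<close> as \<open>C (e - A s') - (C e - k)\<close>: the first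
  term is in the cone of the larger set, and the second, being in \<open>U\<close>, does not act on
  differences of points of \<open>V\<close>.\<close>

lemma sweeping_inclusion:
  assumes "C e - k \<in> U" "s - a t \<in> V" and n: "e - A s' \<in> normal_cone inner \<Sigma> s"
  shows "- (s' - k) \<in> normal_cone (inner_inv C) (moving_set W0 E \<Sigma> a t) (s - a t)"
proof -
  have n: "C (e - A s') \<in> normal_cone (inner_inv C) (translate \<Sigma> (- a t)) (s - a t)"
    using n by (simp only: normal_cone_weighted_iff)
  have "inner_inv C (- (s' - k)) (c - (s - a t)) \<le> 0" if c: "c \<in> translate \<Sigma> (- a t)" "c \<in> V" for c
  proof -
    have "inner (C e - k) (A (c - (s - a t))) = 0"
      by (rule U_V_orthogonal[OF assms(1) V_diff[OF c(2) assms(2)]])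
    moreover have "inner (C (e - A s')) (A (c - (s - a t))) \<le> 0"
      using n c(1) by (auto simp: normal_cone_def inner_inv_def)
    ultimately show ?thesis by (simp add: inner_inv_def C.diff inner_diff_left)
  qed
  then show ?thesis using n assms(2) by (auto simp: normal_cone_def moving_set_def)
qed

end


section \<open>Equivalence of the evolution problem and the inclusions\<close>

theorem theorem4p1:
  fixes T c0 :: real
    and W0 :: "'x::banach set"
    and E :: "'x \<Rightarrow> 'h::{real_inner,banach,second_countable_topology}"
    and C :: "'h \<Rightarrow> 'h"
    and g :: "real \<Rightarrow> 'h"
    and f :: "real \<Rightarrow> 'x \<Rightarrow> real"
    and \<Sigma> :: "'h set"
    and \<epsilon>0 \<epsilon>el0 \<epsilon>p0 \<sigma>0 :: 'h
    and \<epsilon> \<epsilon>el \<epsilon>p \<sigma> :: "real \<Rightarrow> 'h"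
  defines "st \<equiv> elastic_stress W0 E C g f"
  assumes "T > 0"
    and "reflexive_space TYPE('x)"
    and "linear_on_subspace W0 E"
    and "closed ((\<lambda>e. (e, E e)) ` W0)"
    and "closed (E ` W0)"
    and "bounded_linear C"
    and "\<And>\<sigma> \<tau>. inner (C \<sigma>) \<tau> = inner \<sigma> (C \<tau>)"
    and "c0 > 0"
    and "\<And>\<tau>. inner (C \<tau>) \<tau> \<ge> c0 * (norm \<tau>)\<^sup>2"
    and "W1_inf T norm g"
    and "W1_inf_dual T (closure W0) (adj_image W0 E) f"
    and "bounded \<Sigma>" and "closed \<Sigma>" and "convex \<Sigma>" and "\<Sigma> \<noteq> {}"
    and "EPP_static W0 E C (g 0) (f 0) \<epsilon>0 \<epsilon>el0 \<epsilon>p0 \<sigma>0"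
    and "\<sigma>0 \<in> \<Sigma>"
  shows "EPP_solution T W0 E C g f \<Sigma> (\<epsilon>0, \<epsilon>el0, \<epsilon>p0, \<sigma>0) \<epsilon> \<epsilon>el \<epsilon>p \<sigma> \<longleftrightarrow>
           sweeping_solution T W0 E C \<Sigma> st (\<sigma>0 - st 0) (\<lambda>t. \<sigma> t - st t) \<and>
           strain_solution T W0 E C \<Sigma> st (\<lambda>t. \<sigma> t - st t) \<epsilon>0 \<epsilon> \<and>
           (\<forall>t\<in>{0..T}. \<epsilon>el t = inv C (\<sigma> t) \<and> \<epsilon>p t = \<epsilon> t - inv C (\<sigma> t))"
proof -
  interpret elasticity c0 W0 E C
    by (rule elasticity.intro) fact+
  have T: "T > 0" and closed\<Sigma>: "closed \<Sigma>" by fact+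
  have fR: "f t \<in> adj_image W0 E" if "t \<in> {0..T}" for t
    using \<open>W1_inf_dual T (closure W0) (adj_image W0 E) f\<close> that by (simp add: W1_inf_dual_def)
  have stW: "W1_inf T norm st"
    unfolding st_def by (intro elastic_stress_W1_inf) fact+
  have static_iff: "EPP_static W0 E C (g t) (f t) e eel ep s \<longleftrightarrow>
      C e - st t \<in> U \<and> e = eel + ep \<and> s = C eel \<and> s - st t \<in> V" if "t \<in> {0..T}" for t e eel ep s
    unfolding st_def by (rule EPP_static_iff[where f=f, OF fR[OF that]])
  have T0: "0 \<in> {0..T}" using T by simp
  have init: "C \<epsilon>0 - st 0 \<in> U" "\<epsilon>0 = \<epsilon>el0 + \<epsilon>p0" "\<sigma>0 = C \<epsilon>el0" "\<sigma>0 - st 0 \<in> V"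
    using \<open>EPP_static W0 E C (g 0) (f 0) \<epsilon>0 \<epsilon>el0 \<epsilon>p0 \<sigma>0\<close> unfolding static_iff[OF T0] by auto
  have in_moving: "s - st t \<in> moving_set W0 E \<Sigma> st t \<longleftrightarrow> s \<in> \<Sigma> \<and> s - st t \<in> V" for s t
    by (simp add: moving_set_def mem_translate)
  have y0: "\<sigma>0 - st 0 \<in> moving_set W0 E \<Sigma> st 0"
    using init(4) \<open>\<sigma>0 \<in> \<Sigma>\<close> by (simp add: in_moving)
  have e0: "\<epsilon>0 \<in> A ` translate U (st 0)"
    using init(1) by (intro image_eqI[of _ _ "C \<epsilon>0"]) (auto simp: mem_translate)
  have ddt_diff: "ddt T (\<lambda>t. u t - w t) t = ddt T u t - ddt T w t" "has_ddt T (\<lambda>t. u t - w t) t"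
    if "has_ddt T u t" "has_ddt T w t" "t \<in> {0..T}" for u w :: "real \<Rightarrow> 'h" and t
    using ddt_eqI[OF T that(3) has_vector_derivative_diff[OF that(1,2)[unfolded has_ddt_iff]]] by auto
  have ddt_plastic: "ddt T \<epsilon>p t = ddt T \<epsilon> t - A (ddt T \<sigma> t)" "has_ddt T \<epsilon>p t"
    if ep: "\<And>t. t \<in> {0..T} \<Longrightarrow> \<epsilon>p t = \<epsilon> t - A (\<sigma> t)" and d: "has_ddt T \<epsilon> t" "has_ddt T \<sigma> t" and t: "t \<in> {0..T}" for t
  proof -
    have "((\<lambda>t. \<epsilon> t - A (\<sigma> t)) has_vector_derivative ddt T \<epsilon> t - A (ddt T \<sigma> t)) (at t within {0..T})"
      using d unfolding has_ddt_iff by (intro has_vector_derivative_diff A.has_vector_derivative)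
    then have "(\<epsilon>p has_vector_derivative ddt T \<epsilon> t - A (ddt T \<sigma> t)) (at t within {0..T})"
      by (rule has_vector_derivative_transform[OF t, rotated]) (rule ep)
    from ddt_eqI[OF T t this] show "ddt T \<epsilon>p t = ddt T \<epsilon> t - A (ddt T \<sigma> t)" "has_ddt T \<epsilon>p t" by auto
  qed
  have ddt_C: "((\<lambda>t. C (\<epsilon> t) - st t) has_vector_derivative C (ddt T \<epsilon> t) - ddt T st t) (at t within {0..T})"
    if "has_ddt T \<epsilon> t" "has_ddt T st t" for t
    using that unfolding has_ddt_iff by (intro has_vector_derivative_diff C.has_vector_derivative)
  show ?thesis
  proof
    assume "EPP_solution T W0 E C g f \<Sigma> (\<epsilon>0, \<epsilon>el0, \<epsilon>p0, \<sigma>0) \<epsilon> \<epsilon>el \<epsilon>p \<sigma>"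
    then have W: "W1_inf T norm \<epsilon>" "W1_inf T norm \<sigma>"
      and EPP: "\<forall>t\<in>{0..T}. EPP_static W0 E C (g t) (f t) (\<epsilon> t) (\<epsilon>el t) (\<epsilon>p t) (\<sigma> t)"
      and flow: "AE t in lebesgue_on {0..T}. has_ddt T \<epsilon>p t \<and> ddt T \<epsilon>p t \<in> normal_cone inner \<Sigma> (\<sigma> t)"
      and start: "\<epsilon> 0 = \<epsilon>0" "\<sigma> 0 = \<sigma>0"
      unfolding EPP_solution_def by auto
    have static: "C (\<epsilon> t) - st t \<in> U \<and> \<epsilon> t = \<epsilon>el t + \<epsilon>p t \<and> \<sigma> t = C (\<epsilon>el t) \<and> \<sigma> t - st t \<in> V"
      if "t \<in> {0..T}" for t
      using EPP that static_iff by blast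
    have eel: "\<epsilon>el t = A (\<sigma> t)" and ep: "\<epsilon>p t = \<epsilon> t - A (\<sigma> t)" if "t \<in> {0..T}" for t
      using static[OF that] by auto
    \<comment> \<open>The flow rule contains admissibility, since \<open>normal_cone\<close> is
      empty at points outside the set.\<close>
    have "AE t in lebesgue_on {0..T}. \<sigma> t \<in> \<Sigma>"
      using flow by eventually_elim (auto simp: normal_cone_def)
    then have in\<Sigma>: "\<sigma> t \<in> \<Sigma>" if "t \<in> {0..T}" for t
      using continuous_AE_closed[OF T W1_inf_continuous_on[OF W(2)] closed\<Sigma> _ that] by blast
    \<comment> \<open>The common rate form of both problems; the converse derives the same list from
      the inclusions. Membership in \<open>U\<close> comes from differentiating the orthogonality to
      \<open>V\<close>.\<close>
    have rates: "AE t in lebesgue_on {0..T}. t \<in> {0..T} \<and> has_ddt T \<epsilon> t \<and> has_ddt T \<sigma> t \<and> has_ddt T st t \<and>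
        C (ddt T \<epsilon> t) - ddt T st t \<in> U \<and> ddt T \<epsilon> t - A (ddt T \<sigma> t) \<in> normal_cone inner \<Sigma> (\<sigma> t)"
      using AE_time W1_inf_AE_has_ddt[OF W(1)] W1_inf_AE_has_ddt[OF W(2)] W1_inf_AE_has_ddt[OF stW] flow
    proof eventually_elim
      case (elim t)
      have "C (ddt T \<epsilon> t) - ddt T st t \<in> U"
        unfolding U_iff
      proof
        fix v assume v: "v \<in> V"
        show "inner (C (ddt T \<epsilon> t) - ddt T st t) (A v) = 0"
          by (rule has_vector_derivative_orthogonal[OF T elim(1) ddt_C[OF elim(2,4)]])
            (use static v U_V_orthogonal in blast)
      qed
      then show ?case using elim ddt_plastic(1)[OF ep elim(2,3,1)] by simp
    qed
    have "sweeping_solution T W0 E C \<Sigma> st (\<sigma>0 - st 0) (\<lambda>t. \<sigma> t - st t)"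
      unfolding sweeping_solution_def
    proof (intro conjI ballI y0)
      show "W1_inf T (norm_inv C) (\<lambda>t. \<sigma> t - st t)"
        using W1_inf_diff[OF W(2) stW] by (simp add: W1_inf_norm_inv)
      show "\<sigma> t - st t \<in> moving_set W0 E \<Sigma> st t" if "t \<in> {0..T}" for t
        unfolding in_moving using static[OF that] in\<Sigma>[OF that] by blast
      show "AE t in lebesgue_on {0..T}. has_ddt T (\<lambda>t. \<sigma> t - st t) t \<and>
          - ddt T (\<lambda>t. \<sigma> t - st t) t \<in> normal_cone (inner_inv C) (moving_set W0 E \<Sigma> st t) (\<sigma> t - st t)"
        using rates
      proof eventually_elim
        case (elim t)
        then have "- (ddt T \<sigma> t - ddt T st t) \<in> normal_cone (inner_inv C) (moving_set W0 E \<Sigma> st t) (\<sigma> t - st t)"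
          using static by (intro sweeping_inclusion[where e="ddt T \<epsilon> t"]) blast+
        then show ?case using elim ddt_diff[of \<sigma> t st] by simp
      qed
    qed (simp add: start)
    moreover have "strain_solution T W0 E C \<Sigma> st (\<lambda>t. \<sigma> t - st t) \<epsilon>0 \<epsilon>"
      unfolding strain_solution_def
    proof (intro conjI W(1) start(1) e0)
      show "AE t in lebesgue_on {0..T}. has_ddt T \<epsilon> t \<and> has_ddt T (\<lambda>t. \<sigma> t - st t) t \<and> has_ddt T st t \<and>
        ddt T \<epsilon> t \<in> A ` translate (translate (normal_cone (inner_inv C) (translate \<Sigma> (- st t)) (\<sigma> t - st t))
          (ddt T (\<lambda>t. \<sigma> t - st t) t) \<inter> U) (ddt T st t)"
        using rates
        by eventually_elim (simp add: ddt_diff strain_rate_iff)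
    qed
    ultimately show "sweeping_solution T W0 E C \<Sigma> st (\<sigma>0 - st 0) (\<lambda>t. \<sigma> t - st t) \<and>
           strain_solution T W0 E C \<Sigma> st (\<lambda>t. \<sigma> t - st t) \<epsilon>0 \<epsilon> \<and>
           (\<forall>t\<in>{0..T}. \<epsilon>el t = inv C (\<sigma> t) \<and> \<epsilon>p t = \<epsilon> t - inv C (\<sigma> t))"
      using eel ep by blast
  next
    assume R: "sweeping_solution T W0 E C \<Sigma> st (\<sigma>0 - st 0) (\<lambda>t. \<sigma> t - st t) \<and>
           strain_solution T W0 E C \<Sigma> st (\<lambda>t. \<sigma> t - st t) \<epsilon>0 \<epsilon> \<and>
           (\<forall>t\<in>{0..T}. \<epsilon>el t = inv C (\<sigma> t) \<and> \<epsilon>p t = \<epsilon> t - inv C (\<sigma> t))"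
    then have yW: "W1_inf T norm (\<lambda>t. \<sigma> t - st t)"
      and y: "\<And>t. t \<in> {0..T} \<Longrightarrow> \<sigma> t \<in> \<Sigma> \<and> \<sigma> t - st t \<in> V"
      and ys: "\<sigma> 0 = \<sigma>0"
      unfolding sweeping_solution_def by (auto simp: W1_inf_norm_inv in_moving)
    have eW: "W1_inf T norm \<epsilon>"
      and strain: "AE t in lebesgue_on {0..T}. has_ddt T \<epsilon> t \<and> has_ddt T (\<lambda>t. \<sigma> t - st t) t \<and> has_ddt T st t \<and>
        ddt T \<epsilon> t \<in> A ` translate (translate (normal_cone (inner_inv C) (translate \<Sigma> (- st t)) (\<sigma> t - st t))
          (ddt T (\<lambda>t. \<sigma> t - st t) t) \<inter> U) (ddt T st t)"
      and es: "\<epsilon> 0 = \<epsilon>0"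
      using R unfolding strain_solution_def by blast+
    \<comment> \<open>The inclusions involve only \<open>y\<close> and \<epsilon>; the third
      conjunct fixes the elastic and plastic strains.\<close>
    have eel: "\<epsilon>el t = A (\<sigma> t)" and ep: "\<epsilon>p t = \<epsilon> t - A (\<sigma> t)" if "t \<in> {0..T}" for t
      using R that by auto
    have sW: "W1_inf T norm \<sigma>" using W1_inf_add[OF yW stW] by simp
    have AsW: "W1_inf T norm (\<lambda>t. A (\<sigma> t))" by (rule W1_inf_bounded_linear[OF sW A_bounded])
    have rates: "AE t in lebesgue_on {0..T}. t \<in> {0..T} \<and> has_ddt T \<epsilon> t \<and> has_ddt T \<sigma> t \<and> has_ddt T st t \<and>
        C (ddt T \<epsilon> t) - ddt T st t \<in> U \<and> ddt T \<epsilon> t - A (ddt T \<sigma> t) \<in> normal_cone inner \<Sigma> (\<sigma> t)"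
      using AE_time W1_inf_AE_has_ddt[OF sW] strain
    proof eventually_elim
      case (elim t)
      \<comment> \<open>Removing the outer translation exposes the intersection with
        \<open>U\<close> in the inclusion.\<close>
      have CU: "C (ddt T \<epsilon> t) - ddt T st t \<in> U"
        using elim(3) by (auto simp: mem_translate)
      have "ddt T (\<lambda>t. \<sigma> t - st t) t = ddt T \<sigma> t - ddt T st t"
        using elim by (intro ddt_diff(1)) auto
      then show ?case
        using elim strain_rate_iff[OF CU, of \<Sigma> "st t" "\<sigma> t" "ddt T \<sigma> t"] CU by simp
    qed
    \<comment> \<open>Compatibility is recovered at every time from the initial datum and the rates,
      one test element of \<open>V\<close> at a time.\<close>
    have "C (\<epsilon> t) - st t \<in> U" if t: "t \<in> {0..T}" for t
      unfolding U_iff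
    proof
      fix v assume v: "v \<in> V"
      show "inner (C (\<epsilon> t) - st t) (A v) = 0"
      proof (rule W1_inf_orthogonal[OF T _ _ _ t])
        show "W1_inf T norm (\<lambda>t. C (\<epsilon> t) - st t)"
          by (rule W1_inf_diff[OF W1_inf_bounded_linear[OF eW C_bounded] stW])
        show "inner (C (\<epsilon> 0) - st 0) (A v) = 0" using init(1) v U_V_orthogonal by (simp add: es)
        show "AE t in lebesgue_on {0..T}. inner (ddt T (\<lambda>t. C (\<epsilon> t) - st t) t) (A v) = 0"
          using rates
        proof eventually_elim
          case (elim t)
          then show ?case using ddt_eqI(2)[OF T _ ddt_C, of t] v U_V_orthogonal by simp
        qed
      qed
    qed
    then have static: "EPP_static W0 E C (g t) (f t) (\<epsilon> t) (\<epsilon>el t) (\<epsilon>p t) (\<sigma> t)" if "t \<in> {0..T}" for t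
      using that y eel ep by (simp add: static_iff)
    show "EPP_solution T W0 E C g f \<Sigma> (\<epsilon>0, \<epsilon>el0, \<epsilon>p0, \<sigma>0) \<epsilon> \<epsilon>el \<epsilon>p \<sigma>"
      unfolding EPP_solution_def
    proof (intro conjI ballI eW sW static)
      show "W1_inf T norm \<epsilon>el" using AsW W1_inf_cong[OF eel T] by simp
      show "W1_inf T norm \<epsilon>p" using W1_inf_diff[OF eW AsW] W1_inf_cong[OF ep T] by simp
      show "AE t in lebesgue_on {0..T}. has_ddt T \<epsilon>p t \<and> ddt T \<epsilon>p t \<in> normal_cone inner \<Sigma> (\<sigma> t)"
        using rates
      proof eventually_elim
        case (elim t)
        then show ?case using ddt_plastic[OF ep, of t] by simp
      qed
      \<comment> \<open>The initial elastic and plastic strains are recovered from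
        \<open>\<sigma>0 = C \<epsilon>el0\<close> and the additive splitting of
        \<open>\<epsilon>0\<close>.\<close>
      show "(\<epsilon> 0, \<epsilon>el 0, \<epsilon>p 0, \<sigma> 0) = (\<epsilon>0, \<epsilon>el0, \<epsilon>p0, \<sigma>0)"
        using eel[OF T0] ep[OF T0] init(2,3) by (simp add: es ys)
    qed
  qed
qed

end
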